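(* Let $N\ge 1$ and $T>0$ be fixed, and let $r:[0,2T]\to\mathbb{R}$ be a function. Then $r$ is the response function of the dynamical system associated with some real $N\times N$ Jacobi matrix $A$ (as defined in the context) if and only if the following conditions hold: (i) $r$ has the form $$r(t)=\sum_{k=1}^N \frac{1}{\rho_k}S(t,\lambda_k),\qquad 0\le t\le 2T,$$ with distinct real numbers $\lambda_1,\dots,\lambda_N$ and positive numbers $\rho_1,\dots,\rho_N$ satisfying $\sum_{k=1}^N \frac1{\rho_k}=1$; (ii) the operator $C^T:L_2(0,T)\to L_2(0,T)$ defined by $$(C^Tf)(t)=\frac12\int_0^T\left(\int_{|t-s|}^{2T-s-t}r(\tau)\,d\tau\right) f(s)\,ds$$ is a finite-rank operator and, with $\mathcal{F}^T_1:=C^T L_2(0,T)$, the restriction $C^T|_{\mathcal{F}^T_1}:\mathcal{F}^T_1\to\mathcal{F}^T_1$ is an isomorphism.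
   Context: All functions and spaces are real. For $\lambda\in\mathbb{R}$ and $t\in\mathbb{R}$ put $S(t,\lambda)=\frac{\sin(\sqrt{\lambda}\,t)}{\sqrt{\lambda}}$ if $\lambda>0$, $S(t,\lambda)=\frac{\sinh(\sqrt{|\lambda|}\,t)}{\sqrt{|\lambda|}}$ if $\lambda<0$, and $S(t,0)=t$. A real $N\times N$ Jacobi matrix $A$ is a symmetric tridiagonal matrix with diagonal entries $b_1,\dots,b_N\in\mathbb{R}$ and off-diagonal entries $A_{i,i+1}=A_{i+1,i}=a_i>0$, $i=1,\dots,N-1$. The dynamical system associated with $A$ is $$u_{tt}(t)+Au(t)=F(t),\ t>0,\qquad u(0)=u_t(0)=0,$$ where $u(t)\in\mathbb{R}^N$ and $F(t)=(f(t),0,\dots,0)$, with $f$ a (locally) $L_2$ function called the boundary control; the solution ($u,u_t$ absolutely continuous, equation satisfied for a.e. $t$) is denoted $u^f$. The response function of the system is the continuous function $r$ such that the first component of the solution is $u_1^f(t)=\int_0^t r(t-s)f(s)\,ds$ for every control $f$; here it is considered for $t\in[0,2T]$. *)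

theory Defs
  imports "HOL-Analysis.Analysis" "Jordan_Normal_Form.Matrix"
begin

no_notation vec_nth (infixl "$" 90)

definition S :: "real \<Rightarrow> real \<Rightarrow> real" where
  "S t l = (if l > 0 then sin (sqrt l * t) / sqrt l
            else if l < 0 then sinh (sqrt \<bar>l\<bar> * t) / sqrt \<bar>l\<bar>
            else t)"

definition jacobi_matrix :: "nat \<Rightarrow> real mat \<Rightarrow> bool" where
  "jacobi_matrix N A \<longleftrightarrow>
     A \<in> carrier_mat N N \<and>
     (\<forall>i<N. \<forall>j<N. A $$ (i, j) = A $$ (j, i)) \<and>
     (\<forall>i<N. \<forall>j<N. i + 1 < j \<longrightarrow> A $$ (i, j) = 0) \<and>
     (\<forall>i. i + 1 < N \<longrightarrow> A $$ (i, i + 1) > 0)"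

(* Absolute continuity of functions on a compact interval, in the classical epsilon-delta form;
   the library constant absolutely_continuous concerns measures. *)
definition abs_continuous_on :: "real \<Rightarrow> real \<Rightarrow> (real \<Rightarrow> real) \<Rightarrow> bool" where
  "abs_continuous_on a b g \<longleftrightarrow>
     (\<forall>\<epsilon>>0. \<exists>\<delta>>0. \<forall>(n::nat) x y.
        (\<forall>i<n. a \<le> x i \<and> x i \<le> y i \<and> y i \<le> b) \<and>
        disjoint_family_on (\<lambda>i. {x i<..<y i}) {..<n} \<and>
        (\<Sum>i<n. y i - x i) < \<delta>
        \<longrightarrow> (\<Sum>i<n. \<bar>g (y i) - g (x i)\<bar>) < \<epsilon>)"

(* Elements of L_2(0,T) are represented by functions on the whole real line; only their
   restrictions to (0,T) matter, and these are identified up to null sets by L2_eq. *)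
definition L2 :: "real \<Rightarrow> (real \<Rightarrow> real) set" where
  "L2 T = {f \<in> borel_measurable (lebesgue_on {0<..<T}).
             integrable (lebesgue_on {0<..<T}) (\<lambda>x. (f x)\<^sup>2)}"

definition L2_eq :: "real \<Rightarrow> (real \<Rightarrow> real) \<Rightarrow> (real \<Rightarrow> real) \<Rightarrow> bool" where
  "L2_eq T f g \<longleftrightarrow> (AE x in lebesgue_on {0<..<T}. f x = g x)"

definition norm_L2 :: "real \<Rightarrow> (real \<Rightarrow> real) \<Rightarrow> real" where
  "norm_L2 T f = sqrt (LINT x|lebesgue_on {0<..<T}. (f x)\<^sup>2)"

definition locally_L2 :: "(real \<Rightarrow> real) \<Rightarrow> bool" where
  "locally_L2 f \<longleftrightarrow> (\<forall>X>0. f \<in> L2 X)"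

(* Vector entries are indexed from 0, so the control acts on, and is observed at, entry 0.
   The witness v is the derivative of u (one-sided at 0), and w is the a.e. existing
   second derivative at t. *)
definition is_solution :: "nat \<Rightarrow> real mat \<Rightarrow> (real \<Rightarrow> real) \<Rightarrow> (real \<Rightarrow> real vec) \<Rightarrow> bool" where
  "is_solution N A f u \<longleftrightarrow>
     (\<exists>v. (\<forall>t\<ge>0. u t \<in> carrier_vec N \<and> v t \<in> carrier_vec N) \<and>
          (\<forall>i<N. (\<forall>X>0. abs_continuous_on 0 X (\<lambda>t. u t $ i)) \<and>
                 (\<forall>X>0. abs_continuous_on 0 X (\<lambda>t. v t $ i)) \<and>
                 (\<forall>t\<ge>0. ((\<lambda>s. u s $ i) has_real_derivative v t $ i) (at t within {0..}))) \<and>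
          u 0 = 0\<^sub>v N \<and> v 0 = 0\<^sub>v N \<and>
          (AE t in lebesgue. t > 0 \<longrightarrow>
             (\<exists>w \<in> carrier_vec N.
                (\<forall>i<N. ((\<lambda>s. v s $ i) has_real_derivative w $ i) (at t)) \<and>
                w + A *\<^sub>v u t = f t \<cdot>\<^sub>v unit_vec N 0)))"

definition is_response_function :: "nat \<Rightarrow> real mat \<Rightarrow> real \<Rightarrow> (real \<Rightarrow> real) \<Rightarrow> bool" where
  "is_response_function N A T r \<longleftrightarrow>
     continuous_on {0..2 * T} r \<and>
     (\<forall>f u. locally_L2 f \<and> is_solution N A f u \<longrightarrow>
        (\<forall>t\<in>{0..2 * T}. u t $ 0 = (LINT s|lebesgue_on {0..t}. r (t - s) * f s)))"

definition C :: "real \<Rightarrow> (real \<Rightarrow> real) \<Rightarrow> (real \<Rightarrow> real) \<Rightarrow> real \<Rightarrow> real" where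
  "C T r f t =
     1 / 2 * (LINT s|lebesgue_on {0..T}.
                (LINT \<tau>|lebesgue_on {\<bar>t - s\<bar>..2 * T - s - t}. r \<tau>) * f s)"

(* Bounded linear maps between subspaces V and W of L_2(0,T) that are closed under L2_eq.
   Such a map respects L2_eq, since it is linear and bounded in the seminorm norm_L2. *)
definition L2_bounded_linear ::
  "real \<Rightarrow> (real \<Rightarrow> real) set \<Rightarrow> (real \<Rightarrow> real) set \<Rightarrow> ((real \<Rightarrow> real) \<Rightarrow> real \<Rightarrow> real) \<Rightarrow> bool" where
  "L2_bounded_linear T V W K \<longleftrightarrow>
     (\<forall>f\<in>V. K f \<in> W) \<and>
     (\<forall>f\<in>V. \<forall>g\<in>V. L2_eq T (K (\<lambda>x. f x + g x)) (\<lambda>x. K f x + K g x)) \<and>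
     (\<forall>c. \<forall>f\<in>V. L2_eq T (K (\<lambda>x. c * f x)) (\<lambda>x. c * K f x)) \<and>
     (\<exists>M. \<forall>f\<in>V. norm_L2 T (K f) \<le> M * norm_L2 T f)"

definition L2_finite_rank :: "real \<Rightarrow> ((real \<Rightarrow> real) \<Rightarrow> real \<Rightarrow> real) \<Rightarrow> bool" where
  "L2_finite_rank T K \<longleftrightarrow>
     L2_bounded_linear T (L2 T) (L2 T) K \<and>
     (\<exists>B. finite B \<and> B \<subseteq> L2 T \<and>
        (\<forall>f\<in>L2 T. \<exists>c. L2_eq T (K f) (\<lambda>x. \<Sum>b\<in>B. c b * b x)))"

definition L2_range :: "real \<Rightarrow> ((real \<Rightarrow> real) \<Rightarrow> real \<Rightarrow> real) \<Rightarrow> (real \<Rightarrow> real) set" where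
  "L2_range T K = {g \<in> L2 T. \<exists>f\<in>L2 T. L2_eq T g (K f)}"

definition L2_isomorphism ::
  "real \<Rightarrow> (real \<Rightarrow> real) set \<Rightarrow> (real \<Rightarrow> real) set \<Rightarrow> ((real \<Rightarrow> real) \<Rightarrow> real \<Rightarrow> real) \<Rightarrow> bool" where
  "L2_isomorphism T V W K \<longleftrightarrow>
     L2_bounded_linear T V W K \<and>
     (\<forall>f\<in>V. \<forall>g\<in>V. L2_eq T (K f) (K g) \<longrightarrow> L2_eq T f g) \<and>
     (\<forall>h\<in>W. \<exists>f\<in>V. L2_eq T (K f) h) \<and>
     (\<exists>M. \<forall>f\<in>V. norm_L2 T f \<le> M * norm_L2 T (K f))"

end

theory Submission
  imports Defs "HOL-Computational_Algebra.Fundamental_Theorem_Algebra" "Jordan_Normal_Form.Determinant"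
begin

text \<open>
  Everything rests on diagonalizing the matrix. If \<open>\<phi>\<^sub>k\<close> are the orthonormal eigenvectors of
  \<open>A\<close>, with eigenvalues \<open>\<lambda>\<^sub>k\<close>, then the system decouples into scalar oscillators
  \<open>y'' + \<lambda>\<^sub>k y = \<phi>\<^sub>k(0) f\<close>, whose solution is a convolution with \<open>S(\<cdot>, \<lambda>\<^sub>k)\<close>. Hence the first
  component of the solution is the convolution of \<open>f\<close> with \<open>\<Sum>\<^sub>k \<phi>\<^sub>k(0)\<^sup>2 S(\<cdot>, \<lambda>\<^sub>k)\<close>
  (\<open>is_response_function_iff\<close>), and condition (i) says that the response function has this shape
  with \<open>1 / \<rho>\<^sub>k = \<phi>\<^sub>k(0)\<^sup>2\<close>. What remains is the classical correspondence between Jacobi matrices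
  and finitely supported probability measures \<open>\<Sum>\<^sub>k m\<^sub>k \<delta>(\<lambda>\<^sub>k)\<close>, through orthogonal polynomials.

  From a Jacobi matrix to the measure (\<open>jacobi_matrix_spectral_data\<close>): the three-term recurrence
  encoded by \<open>A\<close> generates polynomials \<open>q\<^sub>0 = 1, q\<^sub>1, \<dots>\<close>, and the roots of \<open>q\<^sub>N\<close> are the eigenvalues,
  with eigenvector \<open>(q\<^sub>0(\<lambda>), \<dots>, q\<^bsub>N-1\<^esub>(\<lambda>))\<close>. The Christoffel-Darboux identity shows at one stroke that these
  roots are real, that they are simple (so that there are \<open>N\<close> of them), and that eigenvectors of different
  eigenvalues are orthogonal. From the measure to the matrix
  (\<open>spectral_data_exists_jacobi_matrix\<close>): orthonormalize the powers of the variable in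
  \<open>L\<^sub>2\<close> of the measure; multiplication by the variable is tridiagonal in the resulting basis.

  That every solution is given by this convolution, although the control is only locally in \<open>L\<^sub>2\<close> and
  the velocity only absolutely continuous, is Duhamel's principle: it is the fundamental theorem of
  calculus for absolutely continuous functions (\<open>abs_continuous_fundamental_theorem\<close>), applied
  to a pairing of the solution with the fundamental solution run backwards. Conversely, testing with
  the constant control \<open>1\<close> gives the integral of the response function, hence the response
  function itself by differentiation.

  Condition (ii) follows from (i). The kernel of \<open>C\<^sup>T\<close> separates, because
  \<open>\<integral> S(\<tau>, \<lambda>) d\<tau>\<close> over \<open>[|t-s|, 2T-s-t]\<close> equals \<open>2 S(T-t, \<lambda>) S(T-s, \<lambda>)\<close>; for
  positive \<open>\<lambda>\<close> this is the identity \<open>cos(\<alpha>-\<beta>) - cos(\<alpha>+\<beta>) = 2 sin \<alpha> sin \<beta>\<close>. So \<open>C\<^sup>T f = \<Sum>\<^sub>k m\<^sub>k \<langle>e\<^sub>k, f\<rangle> e\<^sub>k\<close> with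
  \<open>e\<^sub>k(t) = S(T-t, \<lambda>\<^sub>k)\<close>, and these functions are linearly independent. On their span, which is the
  range, the operator is the product of the Gram matrix with a positive diagonal matrix, and both are invertible
  (\<open>K_isomorphism_on_range\<close>).
\<close>

section \<open>Absolutely continuous functions\<close>

text \<open>The definition numbers the intervals by an initial segment of the naturals. The pieces of a tagged
  division come without such a numbering, so the index set is freed here.\<close>
lemma abs_continuous_sum_over_finite:
  assumes "abs_continuous_on a b g" "e > 0"
  shows "\<exists>d>0. \<forall>(I::'i set) x y. finite I \<longrightarrow> (\<forall>i\<in>I. a \<le> x i \<and> x i \<le> y i \<and> y i \<le> b) \<longrightarrow>
       disjoint_family_on (\<lambda>i. {x i<..<y i}) I \<longrightarrow> (\<Sum>i\<in>I. y i - x i) < d \<longrightarrow>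
       (\<Sum>i\<in>I. \<bar>g (y i) - g (x i)\<bar>) < e"
proof -
  obtain d where d: "d > 0" and D: "\<And>(n::nat) x y. (\<forall>i<n. a \<le> x i \<and> x i \<le> y i \<and> y i \<le> b) \<Longrightarrow>
       disjoint_family_on (\<lambda>i. {x i<..<y i}) {..<n} \<Longrightarrow> (\<Sum>i<n. y i - x i) < d \<Longrightarrow>
       (\<Sum>i<n. \<bar>g (y i) - g (x i)\<bar>) < e"
    using assms unfolding abs_continuous_on_def by meson
  show ?thesis
  proof (intro exI[of _ d] conjI allI impI d)
    fix I :: "'i set" and x y
    assume fin: "finite I" and bnd: "\<forall>i\<in>I. a \<le> x i \<and> x i \<le> y i \<and> y i \<le> b"
      and disj: "disjoint_family_on (\<lambda>i. {x i<..<y i}) I" and len: "(\<Sum>i\<in>I. y i - x i) < d"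
    obtain h where h: "bij_betw h {..<card I} I"
      using ex_bij_betw_nat_finite[OF fin] by (auto simp: atLeast0LessThan)
    have hI: "h i \<in> I" if "i < card I" for i using bij_betwE[OF h] that by auto
    have inj: "i = j" if "i < card I" "j < card I" "h i = h j" for i j
      using bij_betw_imp_inj_on[OF h] that by (auto simp: inj_on_def)
    have "(\<Sum>i<card I. \<bar>g (y (h i)) - g (x (h i))\<bar>) < e"
    proof (rule D)
      show "\<forall>i<card I. a \<le> x (h i) \<and> x (h i) \<le> y (h i) \<and> y (h i) \<le> b" using hI bnd by blast
      show "disjoint_family_on (\<lambda>i. {x (h i)<..<y (h i)}) {..<card I}"
        unfolding disjoint_family_on_def
      proof (intro ballI impI)
        fix i j assume "i \<in> {..<card I}" "j \<in> {..<card I}" "i \<noteq> j"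
        then have "h i \<in> I" "h j \<in> I" "h i \<noteq> h j" using hI inj by auto
        then show "{x (h i)<..<y (h i)} \<inter> {x (h j)<..<y (h j)} = {}"
          using disj unfolding disjoint_family_on_def by blast
      qed
      show "(\<Sum>i<card I. y (h i) - x (h i)) < d"
        using len sum.reindex_bij_betw[OF h, of "\<lambda>i. y i - x i"] by simp
    qed
    then show "(\<Sum>i\<in>I. \<bar>g (y i) - g (x i)\<bar>) < e"
      using sum.reindex_bij_betw[OF h, of "\<lambda>i. \<bar>g (y i) - g (x i)\<bar>"] by simp
  qed
qed

text \<open>The Riemann sums of the Henstock-Kurzweil integral can be compared with the increments of \<open>g\<close> piece by
  piece. At tags where the derivative exists, the gauge enforces the usual linear approximation. The other tags
  form a null set; it is covered by an open set of small measure, the gauge keeps the corresponding intervals inside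
  this set, and absolute continuity bounds the increments over them.\<close>
theorem abs_continuous_fundamental_theorem:
  fixes g h :: "real \<Rightarrow> real"
  assumes "a < b" and ac: "abs_continuous_on a b g"
    and ae: "AE x in lebesgue. x \<in> {a<..<b} \<longrightarrow> (g has_real_derivative h x) (at x)"
  shows "(h has_integral (g b - g a)) {a..b}"
proof -
  obtain N0 where N0: "N0 \<in> null_sets lebesgue"
    and N0s: "\<And>x. x \<in> space lebesgue - N0 \<Longrightarrow> x \<in> {a<..<b} \<longrightarrow> (g has_real_derivative h x) (at x)"
    using AE_E3[OF ae] by metis
  have N0': "(g has_real_derivative h x) (at x)" if "x \<notin> N0" "x \<in> {a<..<b}" for x
    using N0s[of x] that by simp
  define N where "N = N0 \<union> {a,b}"
  have negN: "negligible N" unfolding N_def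
    using N0 by (simp add: negligible_iff_null_sets[symmetric] negligible_Un)
  have deriv: "(g has_real_derivative h x) (at x)" if "x \<notin> N" "x \<in> {a..b}" for x
    using N0'[of x] that by (auto simp: N_def)
  define h' where "h' x = (if x \<in> N then 0 else h x)" for x
  have "(h' has_integral (g b - g a)) {a..b}"
    unfolding has_integral box_real[symmetric]
  proof (intro allI impI)
    fix e :: real assume e: "e > 0"
    define e1 where "e1 = e / (4 * (b - a))"
    have e1: "e1 > 0" using e assms(1) by (simp add: e1_def)
    have "e/2 > 0" using e by simp
    obtain \<delta> where \<delta>AC: "\<delta> > 0 \<and> (\<forall>(I::(real \<times> real set) set) x y. finite I \<longrightarrow>
       (\<forall>i\<in>I. a \<le> x i \<and> x i \<le> y i \<and> y i \<le> b) \<longrightarrow>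
       disjoint_family_on (\<lambda>i. {x i<..<y i}) I \<longrightarrow> (\<Sum>i\<in>I. y i - x i) < \<delta> \<longrightarrow>
       (\<Sum>i\<in>I. \<bar>g (y i) - g (x i)\<bar>) < e/2)"
      using abs_continuous_sum_over_finite[OF ac \<open>e/2 > 0\<close>] by (rule exE)
    note \<delta> = conjunct1[OF \<delta>AC] and AC = conjunct2[OF \<delta>AC, rule_format]
    obtain U where U: "open U" "N \<subseteq> U" "U - N \<in> lmeasurable" "emeasure lebesgue (U - N) < ennreal \<delta>"
      using sets_lebesgue_outer_open[OF negligible_imp_sets[OF negN] \<delta>] by blast
    have Ulm: "U \<in> lmeasurable"
      using fmeasurable.Un[OF U(3) negligible_imp_measurable[OF negN]] U(2) by (simp add: Un_absorb2)
    have "measure lebesgue U = measure lebesgue (U - N)"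
      using measure_Diff_null_set[of U lebesgue N] Ulm negN
      by (simp add: negligible_iff_null_sets fmeasurableD)
    \<comment> \<open>The bound on the length in the definition of absolute continuity is met because \<open>N\<close> is null.\<close>
    then have mU: "measure lebesgue U < \<delta>"
      using U(3,4) \<delta> by (simp add: emeasure_eq_measure2 ennreal_less_iff)
    have "\<exists>d. d > 0 \<and> (x \<in> N \<longrightarrow> ball x d \<subseteq> U) \<and> (x \<notin> N \<and> x \<in> {a..b} \<longrightarrow>
             (\<forall>y. \<bar>y - x\<bar> < d \<longrightarrow> \<bar>g y - g x - (y - x) * h x\<bar> \<le> e1 * \<bar>y - x\<bar>))" for x
    proof (cases "x \<in> N")
      case True
      then show ?thesis using U(1,2) by (meson open_contains_ball subsetD)
    next
      case False
      show ?thesis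
      proof (cases "x \<in> {a..b}")
        case True
        have "(g has_derivative (\<lambda>y. y * h x)) (at x within UNIV)"
          using deriv[OF False True] by (simp add: has_field_derivative_def mult.commute[of _ "h x"])
        then have "\<forall>e>0. \<exists>d>0. \<forall>y\<in>UNIV. norm (y - x) < d \<longrightarrow>
                     norm (g y - g x - (y - x) * h x) \<le> e * norm (y - x)"
          unfolding has_derivative_within_alt by (rule conjunct2)
        then obtain d where "d > 0" "\<forall>y\<in>UNIV. norm (y - x) < d \<longrightarrow>
                     norm (g y - g x - (y - x) * h x) \<le> e1 * norm (y - x)"
          using e1 by blast
        then show ?thesis using False by (intro exI[of _ d]) simp
      qed (use False in \<open>auto intro: exI[of _ 1]\<close>)
    qed
    then have "\<exists>d. \<forall>x. d x > 0 \<and> (x \<in> N \<longrightarrow> ball x (d x) \<subseteq> U) \<and> (x \<notin> N \<and> x \<in> {a..b} \<longrightarrow>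
             (\<forall>y. \<bar>y - x\<bar> < d x \<longrightarrow> \<bar>g y - g x - (y - x) * h x\<bar> \<le> e1 * \<bar>y - x\<bar>))"
      by (intro choice allI)
    then obtain d where d0: "\<And>x. d x > 0" and dN: "\<And>x. x \<in> N \<Longrightarrow> ball x (d x) \<subseteq> U"
      and dD: "\<And>x y. x \<notin> N \<Longrightarrow> x \<in> {a..b} \<Longrightarrow> \<bar>y - x\<bar> < d x \<Longrightarrow>
                 \<bar>g y - g x - (y - x) * h x\<bar> \<le> e1 * \<bar>y - x\<bar>"
      by blast
    show "\<exists>\<gamma>. gauge \<gamma> \<and> (\<forall>p. p tagged_division_of cbox a b \<and> \<gamma> fine p \<longrightarrow>
              norm ((\<Sum>(x, k)\<in>p. measure lborel k *\<^sub>R h' x) - (g b - g a)) < e)"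
    proof (rule exI, intro conjI allI impI)
      show "gauge (\<lambda>x. ball x (d x))" using d0 gauge_ball_dependent by blast
    next
      fix p assume "p tagged_division_of cbox a b \<and> (\<lambda>x. ball x (d x)) fine p"
      then have p: "p tagged_division_of cbox a b" and fine: "(\<lambda>x. ball x (d x)) fine p" by auto
      have finp: "finite p" using p by blast
      have ba: "b - a = (\<Sum>(x,K)\<in>p. Sup K - Inf K)" "g b - g a = (\<Sum>(x,K)\<in>p. g(Sup K) - g(Inf K))"
        using additive_tagged_division_1[of a b p "\<lambda>x. x"] additive_tagged_division_1[of a b p g]
              \<open>a < b\<close> p by auto
      have K: "\<exists>u v. K = {u..v} \<and> u \<le> v \<and> Inf K = u \<and> Sup K = v \<and> a \<le> u \<and> v \<le> b \<and> x \<in> {u..v} \<and> measure lborel K = v - u"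
        if "(x,K) \<in> p" for x and K :: "real set"
      proof -
        obtain u v where uv: "K = cbox u v" using p \<open>(x,K) \<in> p\<close> by blast
        have "x \<in> K" "K \<subseteq> cbox a b" using p \<open>(x,K) \<in> p\<close> by blast+
        then show ?thesis using uv by (intro exI[of _ u] exI[of _ v]) auto
      qed
      have Kball: "K \<subseteq> ball x (d x)" if "(x,K) \<in> p" for x K using fine that by blast
      define pN where "pN = {i \<in> p. fst i \<in> N}"
      have pN: "finite pN" "pN \<subseteq> p" using finp by (auto simp: pN_def)
      let ?l = "\<lambda>i::real\<times>real set. Inf (snd i)" and ?r = "\<lambda>i::real\<times>real set. Sup (snd i)"
      \<comment> \<open>Distinct tagged intervals overlap at most in end points, so their open interiors are disjoint subsets of \<open>U\<close>.\<close>
      have disj: "disjoint_family_on (\<lambda>i. {?l i<..<?r i}) pN"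
        unfolding disjoint_family_on_def
      proof (intro ballI impI)
        fix i j assume ij: "i \<in> pN" "j \<in> pN" "i \<noteq> j"
        obtain x K where i: "i = (x,K)" by force
        obtain y L where j: "j = (y,L)" by force
        have mem: "(x,K) \<in> p" "(y,L) \<in> p" using ij i j by (auto simp: pN_def)
        have "interior K \<inter> interior L = {}"
          using p mem ij i j by (metis tagged_division_ofD(5))
        moreover have "interior K = {Inf K<..<Sup K}" "interior L = {Inf L<..<Sup L}"
          using K[OF mem(1)] K[OF mem(2)] interior_atLeastAtMost_real by metis+
        ultimately show "{?l i<..<?r i} \<inter> {?l j<..<?r j} = {}" by (simp add: i j)
      qed
      have sub: "{?l i<..<?r i} \<subseteq> U" if i: "i \<in> pN" for i
      proof -
        obtain x L where i: "i = (x,L)" "(x,L) \<in> p" "x \<in> N" using i by (cases i) (auto simp: pN_def)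
        show ?thesis using K[OF i(2)] Kball[OF i(2)] dN[OF i(3)] i(1) by fastforce
      qed
      have le: "a \<le> ?l i \<and> ?l i \<le> ?r i \<and> ?r i \<le> b" if "i \<in> pN" for i
        using K[of "fst i" "snd i"] that pN by auto
      have "(\<Sum>i\<in>pN. ?r i - ?l i) = (\<Sum>i\<in>pN. measure lebesgue {?l i<..<?r i})"
        using le by (intro sum.cong) auto
      also have "\<dots> = measure lebesgue (\<Union>i\<in>pN. {?l i<..<?r i})"
        using pN(1) disj le by (intro measure_finite_Union[symmetric]) (auto simp: emeasure_lborel_Ioo)
      also have "\<dots> \<le> measure lebesgue U"
        using sub Ulm pN(1) by (intro measure_mono_fmeasurable) auto
      finally have "(\<Sum>i\<in>pN. ?r i - ?l i) < \<delta>" using mU by simp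
      then have small: "(\<Sum>i\<in>pN. \<bar>g (?r i) - g (?l i)\<bar>) < e/2"
        by (intro AC[OF pN(1) _ disj]) (use le in auto)
      have pd: "p = pN \<union> (p - pN)" using pN by blast
      have tagged: "\<bar>measure lborel (snd i) * h' (fst i) - (g (?r i) - g (?l i))\<bar> \<le> e1 * (?r i - ?l i)" if i: "i \<in> p - pN" for i
      proof -
        obtain x L where ix: "i = (x,L)" by force
        then have xL: "(x,L) \<in> p" "x \<notin> N" using i by (auto simp: pN_def)
        obtain u v where uv: "L = {u..v}" "u \<le> v" "Inf L = u" "Sup L = v" "a \<le> u" "v \<le> b" "x \<in> {u..v}" "measure lborel L = v - u"
          using K[OF xL(1)] by blast
        have "u \<in> ball x (d x)" "v \<in> ball x (d x)" using Kball[OF xL(1)] uv(1,2) by (metis atLeastAtMost_iff order_refl subsetD)+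
        then have "\<bar>g u - g x - (u - x) * h x\<bar> \<le> e1 * \<bar>u - x\<bar>" "\<bar>g v - g x - (v - x) * h x\<bar> \<le> e1 * \<bar>v - x\<bar>"
          using uv(5-7) xL dD[of x u] dD[of x v] by (simp_all add: dist_real_def abs_minus_commute)
        moreover have "(v - u) * h x - (g v - g u) =
            (g u - g x - (u - x) * h x) - (g v - g x - (v - x) * h x)" by (simp add: algebra_simps)
        moreover have "e1 * \<bar>u - x\<bar> + e1 * \<bar>v - x\<bar> = e1 * (v - u)"
          using uv(2,7) by (simp add: abs_if algebra_simps)
        ultimately have "\<bar>(v - u) * h x - (g v - g u)\<bar> \<le> e1 * (v - u)" by linarith
        then show ?thesis using ix uv xL by (simp add: h'_def)
      qed
      let ?F = "\<lambda>i. measure lborel (snd i) * h' (fst i) - (g (?r i) - g (?l i))"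
      have total: "(\<Sum>(x, k)\<in>p. measure lborel k *\<^sub>R h' x) - (g b - g a) = (\<Sum>i\<in>p. ?F i)"
        unfolding ba by (simp add: sum_subtractf case_prod_unfold)
      have split: "(\<Sum>i\<in>p. ?F i) = (\<Sum>i\<in>p - pN. ?F i) + (\<Sum>i\<in>pN. ?F i)"
        by (rule sum.subset_diff[OF pN(2) finp])
      have "\<bar>\<Sum>i\<in>pN. ?F i\<bar> \<le> (\<Sum>i\<in>pN. \<bar>?F i\<bar>)" by (rule sum_abs)
      also have "(\<Sum>i\<in>pN. \<bar>?F i\<bar>) = (\<Sum>i\<in>pN. \<bar>g (?r i) - g (?l i)\<bar>)"
        by (rule sum.cong) (auto simp: h'_def pN_def)
      finally have part1: "\<bar>\<Sum>i\<in>pN. ?F i\<bar> < e / 2" using small by linarith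
      have "\<bar>\<Sum>i\<in>p - pN. ?F i\<bar> \<le> (\<Sum>i\<in>p - pN. \<bar>?F i\<bar>)" by (rule sum_abs)
      also have "\<dots> \<le> (\<Sum>i\<in>p - pN. e1 * (?r i - ?l i))"
        using tagged by (intro sum_mono)
      also have "\<dots> \<le> (\<Sum>i\<in>p. e1 * (?r i - ?l i))"
      proof (rule sum_mono2[OF finp])
        fix i assume "i \<in> p - (p - pN)"
        then have "?l i \<le> ?r i" using le by blast
        then show "0 \<le> e1 * (?r i - ?l i)" using e1 by simp
      qed simp
      also have "\<dots> = e1 * (b - a)"
        unfolding ba(1) by (simp add: sum_distrib_left case_prod_unfold)
      also have "\<dots> = e / 4" proof -
        have "e / (4 * c) * c = e / 4" if "c > 0" for c using that by simp
        then show ?thesis using assms(1) by (simp only: e1_def diff_gt_0_iff_gt)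
      qed
      finally have part2: "\<bar>\<Sum>i\<in>p - pN. ?F i\<bar> \<le> e / 4" .
      show "norm ((\<Sum>(x, k)\<in>p. measure lborel k *\<^sub>R h' x) - (g b - g a)) < e"
        unfolding total split real_norm_def using part1 part2 e by linarith
    qed
  qed
  moreover have "h x = h' x" if "x \<in> {a..b} - N" for x using that by (simp add: h'_def)
  ultimately show ?thesis using has_integral_spike[OF negN, of "{a..b}" h h'] by blast
qed

text \<open>A function whose increments are controlled by those of two absolutely continuous functions is itself
  absolutely continuous; sums, products and Lipschitz functions are instances.\<close>
lemma abs_continuous_on_dominated:
  assumes f: "abs_continuous_on a b f" and g: "abs_continuous_on a b g"
    and dom: "\<And>x y. a \<le> x \<Longrightarrow> x \<le> y \<Longrightarrow> y \<le> b \<Longrightarrow> \<bar>h y - h x\<bar> \<le> M * (\<bar>f y - f x\<bar> + \<bar>g y - g x\<bar>)"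
  shows "abs_continuous_on a b h"
  unfolding abs_continuous_on_def
proof (intro allI impI)
  fix e :: real assume e: "e > 0"
  define M' where "M' = \<bar>M\<bar> + 1"
  have M': "M' > 0" "M \<le> M'" by (auto simp: M'_def)
  have pos: "e / (2 * M') > 0" using e M' by simp
  obtain d1 where d1: "d1 > 0" and D1: "\<And>(n::nat) x y. (\<forall>i<n. a \<le> x i \<and> x i \<le> y i \<and> y i \<le> b) \<and>
       disjoint_family_on (\<lambda>i. {x i<..<y i}) {..<n} \<and> (\<Sum>i<n. y i - x i) < d1 \<Longrightarrow>
       (\<Sum>i<n. \<bar>f (y i) - f (x i)\<bar>) < e / (2 * M')"
    using f[unfolded abs_continuous_on_def, rule_format, OF pos] by auto
  obtain d2 where d2: "d2 > 0" and D2: "\<And>(n::nat) x y. (\<forall>i<n. a \<le> x i \<and> x i \<le> y i \<and> y i \<le> b) \<and>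
       disjoint_family_on (\<lambda>i. {x i<..<y i}) {..<n} \<and> (\<Sum>i<n. y i - x i) < d2 \<Longrightarrow>
       (\<Sum>i<n. \<bar>g (y i) - g (x i)\<bar>) < e / (2 * M')"
    using g[unfolded abs_continuous_on_def, rule_format, OF pos] by auto
  show "\<exists>d>0. \<forall>(n::nat) x y. (\<forall>i<n. a \<le> x i \<and> x i \<le> y i \<and> y i \<le> b) \<and>
       disjoint_family_on (\<lambda>i. {x i<..<y i}) {..<n} \<and> (\<Sum>i<n. y i - x i) < d \<longrightarrow>
       (\<Sum>i<n. \<bar>h (y i) - h (x i)\<bar>) < e"
  proof (intro exI[of _ "min d1 d2"] conjI allI impI)
    fix n :: nat and x y
    assume A: "(\<forall>i<n. a \<le> x i \<and> x i \<le> y i \<and> y i \<le> b) \<and>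
       disjoint_family_on (\<lambda>i. {x i<..<y i}) {..<n} \<and> (\<Sum>i<n. y i - x i) < min d1 d2"
    have 1: "(\<Sum>i<n. \<bar>f (y i) - f (x i)\<bar>) < e / (2 * M')" using A by (intro D1) simp
    have 2: "(\<Sum>i<n. \<bar>g (y i) - g (x i)\<bar>) < e / (2 * M')" using A by (intro D2) simp
    have "(\<Sum>i<n. \<bar>h (y i) - h (x i)\<bar>) \<le> (\<Sum>i<n. M' * (\<bar>f (y i) - f (x i)\<bar> + \<bar>g (y i) - g (x i)\<bar>))"
    proof (rule sum_mono)
      fix i assume "i \<in> {..<n}"
      then have "\<bar>h (y i) - h (x i)\<bar> \<le> M * (\<bar>f (y i) - f (x i)\<bar> + \<bar>g (y i) - g (x i)\<bar>)"
        using A by (intro dom) auto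
      also have "\<dots> \<le> M' * (\<bar>f (y i) - f (x i)\<bar> + \<bar>g (y i) - g (x i)\<bar>)"
        by (intro mult_right_mono M') simp
      finally show "\<bar>h (y i) - h (x i)\<bar> \<le> \<dots>" .
    qed
    also have "\<dots> = M' * ((\<Sum>i<n. \<bar>f (y i) - f (x i)\<bar>) + (\<Sum>i<n. \<bar>g (y i) - g (x i)\<bar>))"
      by (simp add: sum_distrib_left sum.distrib distrib_left)
    also have "\<dots> < M' * (e / (2 * M') + e / (2 * M'))"
      using 1 2 M' by (intro mult_strict_left_mono add_strict_mono)
    also have "\<dots> = e" using M' by (simp add: field_simps)
    finally show "(\<Sum>i<n. \<bar>h (y i) - h (x i)\<bar>) < e" .
  qed (use d1 d2 in auto)
qed

lemma abs_continuous_on_ident: "abs_continuous_on a b (\<lambda>x. x)"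
  unfolding abs_continuous_on_def
proof (intro allI impI)
  fix e :: real assume "e > 0"
  then show "\<exists>d>0. \<forall>(n::nat) x y. (\<forall>i<n. a \<le> x i \<and> x i \<le> y i \<and> y i \<le> b) \<and>
       disjoint_family_on (\<lambda>i. {x i<..<y i}) {..<n} \<and> (\<Sum>i<n. y i - x i) < d \<longrightarrow>
       (\<Sum>i<n. \<bar>y i - x i\<bar>) < e"
    by (intro exI[of _ e]) auto
qed

lemma abs_continuous_on_const: "abs_continuous_on a b (\<lambda>x. c)"
  by (rule abs_continuous_on_dominated[OF abs_continuous_on_ident abs_continuous_on_ident, of _ _ _ 0]) simp

lemma abs_continuous_on_add:
  assumes "abs_continuous_on a b f" "abs_continuous_on a b g"
  shows "abs_continuous_on a b (\<lambda>x. f x + g x)"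
  by (rule abs_continuous_on_dominated[OF assms, of _ 1]) auto

lemma abs_continuous_on_sum:
  assumes "\<And>i. i \<in> I \<Longrightarrow> abs_continuous_on a b (f i)"
  shows "abs_continuous_on a b (\<lambda>x. \<Sum>i\<in>I. f i x)"
  using assms
  by (induction I rule: infinite_finite_induct) (auto intro: abs_continuous_on_add abs_continuous_on_const)

lemma abs_continuous_on_imp_continuous_on:
  assumes "abs_continuous_on a b f"
  shows "continuous_on {a..b} f"
  unfolding continuous_on_iff
proof (intro ballI allI impI)
  fix x e :: real assume x: "x \<in> {a..b}" and e: "e > 0"
  obtain d where d: "d > 0" and D: "\<And>(n::nat) x y. (\<forall>i<n. a \<le> x i \<and> x i \<le> y i \<and> y i \<le> b) \<and>
       disjoint_family_on (\<lambda>i. {x i<..<y i}) {..<n} \<and> (\<Sum>i<n. y i - x i) < d \<Longrightarrow>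
       (\<Sum>i<n. \<bar>f (y i) - f (x i)\<bar>) < e"
    using assms[unfolded abs_continuous_on_def, rule_format, OF e] by auto
  show "\<exists>d>0. \<forall>x'\<in>{a..b}. dist x' x < d \<longrightarrow> dist (f x') (f x) < e"
  proof (intro exI[of _ d] conjI ballI impI d)
    fix x' assume x': "x' \<in> {a..b}" "dist x' x < d"
    show "dist (f x') (f x) < e"
    proof (cases "x \<le> x'")
      case True
      then show ?thesis using D[of 1 "\<lambda>_. x" "\<lambda>_. x'"] x x'
        by (simp add: dist_real_def disjoint_family_on_def)
    next
      case False
      then show ?thesis using D[of 1 "\<lambda>_. x'" "\<lambda>_. x"] x x'
        by (simp add: dist_real_def disjoint_family_on_def abs_minus_commute)
    qed
  qed
qed

lemma abs_continuous_on_mult: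
  assumes "abs_continuous_on a b f" "abs_continuous_on a b g"
  shows "abs_continuous_on a b (\<lambda>x. f x * g x)"
proof -
  have "bounded (f ` {a..b})" "bounded (g ` {a..b})"
    by (intro compact_imp_bounded compact_continuous_image abs_continuous_on_imp_continuous_on assms compact_Icc)+
  then obtain F G where F: "\<forall>z\<in>f ` {a..b}. norm z \<le> F" and G: "\<forall>z\<in>g ` {a..b}. norm z \<le> G"
    unfolding bounded_iff by blast
  define M where "M = max F G"
  show ?thesis
  proof (rule abs_continuous_on_dominated[OF assms, of _ M])
    fix x y assume xy: "a \<le> x" "x \<le> y" "y \<le> b"
    have "f y * g y - f x * g x = g y * (f y - f x) + f x * (g y - g x)" by (simp add: algebra_simps)
    then have "\<bar>f y * g y - f x * g x\<bar> \<le> \<bar>g y\<bar> * \<bar>f y - f x\<bar> + \<bar>f x\<bar> * \<bar>g y - g x\<bar>"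
      by (metis abs_mult abs_triangle_ineq)
    also have "\<dots> \<le> M * \<bar>f y - f x\<bar> + M * \<bar>g y - g x\<bar>"
      using F G xy by (intro add_mono mult_right_mono) (auto simp: M_def le_max_iff_disj)
    finally show "\<bar>f y * g y - f x * g x\<bar> \<le> M * (\<bar>f y - f x\<bar> + \<bar>g y - g x\<bar>)"
      by (simp add: distrib_left)
  qed
qed

lemma abs_continuous_on_C1:
  assumes deriv: "\<And>x. x \<in> {a..b} \<Longrightarrow> (f has_real_derivative f' x) (at x within {a..b})"
    and cont: "continuous_on {a..b} f'"
  shows "abs_continuous_on a b f"
proof -
  have "bounded (f' ` {a..b})"
    by (intro compact_imp_bounded compact_continuous_image cont compact_Icc)
  then obtain M where M: "\<forall>z\<in>f' ` {a..b}. norm z \<le> M"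
    unfolding bounded_iff by blast
  show ?thesis
  proof (rule abs_continuous_on_dominated[OF abs_continuous_on_ident abs_continuous_on_const, of _ _ _ M])
    fix x y assume xy: "a \<le> x" "x \<le> y" "y \<le> b"
    have "norm (f y - f x) \<le> M * norm (y - x)"
      using xy M by (intro field_differentiable_bound[of "{a..b}" f f'] deriv) auto
    then show "\<bar>f y - f x\<bar> \<le> M * (\<bar>y - x\<bar> + \<bar>(0::real) - 0\<bar>)" by simp
  qed
qed

section \<open>Square-integrable functions\<close>

text \<open>On a bounded interval \<open>\<bar>f\<bar> \<le> 1 + f\<^sup>2\<close>, so \<open>f\<close> is integrable. The second form serves the integrals over
  closed intervals in the definitions of the response function and of \<^const>\<open>C\<close>.\<close>
lemma L2_mult_continuous:
  assumes f: "f \<in> L2 X" and e: "continuous_on {0..X} e"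
  shows "(\<lambda>s. e s * f s) absolutely_integrable_on {0<..<X}" "(\<lambda>s. e s * f s) absolutely_integrable_on {0..X}"
proof -
  interpret finite_measure "lebesgue_on {0<..<X}"
    by (intro finite_measure_lebesgue_on) auto
  have meas: "f \<in> borel_measurable (lebesgue_on {0<..<X})"
    and sq: "integrable (lebesgue_on {0<..<X}) (\<lambda>x. (f x)\<^sup>2)" using f by (auto simp: L2_def)
  have "integrable (lebesgue_on {0<..<X}) (norm \<circ> f)"
  proof (rule Bochner_Integration.integrable_bound[of _ "\<lambda>x. 1 + (f x)\<^sup>2"])
    show "integrable (lebesgue_on {0<..<X}) (\<lambda>x. 1 + (f x)\<^sup>2)" using sq by simp
    show "norm \<circ> f \<in> borel_measurable (lebesgue_on {0<..<X})" using meas by (simp add: comp_def)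
    have "\<bar>y\<bar> \<le> 1 + y\<^sup>2" for y :: real
      using zero_le_power2[of "\<bar>y\<bar> - 1"] by (simp add: power2_diff)
    then show "AE x in lebesgue_on {0<..<X}. norm ((norm \<circ> f) x) \<le> norm (1 + (f x)\<^sup>2)"
      by (intro AE_I2) auto
  qed
  then have abs: "f absolutely_integrable_on {0<..<X}"
    using meas by (simp add: absolutely_integrable_measurable)
  have "bounded (e ` {0..X})"
    by (intro compact_imp_bounded compact_continuous_image e compact_Icc)
  then have "bounded (e ` {0<..<X})" by (rule bounded_subset) auto
  moreover have "e \<in> borel_measurable (lebesgue_on {0<..<X})"
    by (rule continuous_imp_measurable_on_sets_lebesgue[OF continuous_on_subset[OF e]]) auto
  ultimately show *: "(\<lambda>s. e s * f s) absolutely_integrable_on {0<..<X}"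
    using abs by (intro absolutely_integrable_bounded_measurable_product_real) auto
  then show "(\<lambda>s. e s * f s) absolutely_integrable_on {0..X}"
    using absolutely_integrable_on_open_interval[where f = "\<lambda>s. e s * f s" and a = 0 and b = X] by simp
qed

lemma L2_const: "(\<lambda>_. c) \<in> L2 X"
proof -
  interpret finite_measure "lebesgue_on {0<..<X}"
    by (intro finite_measure_lebesgue_on) auto
  show ?thesis by (simp add: L2_def)
qed

definition L2_inner :: "real \<Rightarrow> (real \<Rightarrow> real) \<Rightarrow> (real \<Rightarrow> real) \<Rightarrow> real" where
  "L2_inner T f g = (LINT x|lebesgue_on {0<..<T}. f x * g x)"

lemma L2_cong:
  assumes "\<And>x. x \<in> {0<..<T} \<Longrightarrow> f x = g x"
  shows "f \<in> L2 T \<longleftrightarrow> g \<in> L2 T"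
proof -
  have "integrable (lebesgue_on {0<..<T}) (\<lambda>x. (f x)\<^sup>2) \<longleftrightarrow> integrable (lebesgue_on {0<..<T}) (\<lambda>x. (g x)\<^sup>2)"
    using assms by (intro Bochner_Integration.integrable_cong) auto
  moreover have "f \<in> borel_measurable (lebesgue_on {0<..<T}) \<longleftrightarrow> g \<in> borel_measurable (lebesgue_on {0<..<T})"
    by (rule measurable_lebesgue_cong[OF assms])
  ultimately show ?thesis by (simp add: L2_def)
qed

lemma L2_add:
  assumes "f \<in> L2 T" "g \<in> L2 T"
  shows "(\<lambda>x. f x + g x) \<in> L2 T"
proof -
  have meas: "f \<in> borel_measurable (lebesgue_on {0<..<T})" "g \<in> borel_measurable (lebesgue_on {0<..<T})"
    and int: "integrable (lebesgue_on {0<..<T}) (\<lambda>x. (f x)\<^sup>2)" "integrable (lebesgue_on {0<..<T}) (\<lambda>x. (g x)\<^sup>2)"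
    using assms by (auto simp: L2_def)
  have "integrable (lebesgue_on {0<..<T}) (\<lambda>x. (f x + g x)\<^sup>2)"
  proof (rule Bochner_Integration.integrable_bound[of _ "\<lambda>x. 2 * (f x)\<^sup>2 + 2 * (g x)\<^sup>2"])
    show "integrable (lebesgue_on {0<..<T}) (\<lambda>x. 2 * (f x)\<^sup>2 + 2 * (g x)\<^sup>2)" using int by simp
    show "(\<lambda>x. (f x + g x)\<^sup>2) \<in> borel_measurable (lebesgue_on {0<..<T})" using meas by simp
    have "(a + b)\<^sup>2 \<le> 2 * a\<^sup>2 + 2 * b\<^sup>2" for a b :: real
      using zero_le_power2[of "a - b"] by (simp add: power2_diff power2_sum)
    then show "AE x in lebesgue_on {0<..<T}. norm ((f x + g x)\<^sup>2) \<le> norm (2 * (f x)\<^sup>2 + 2 * (g x)\<^sup>2)"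
      by (intro AE_I2) auto
  qed
  then show ?thesis using meas by (simp add: L2_def)
qed

lemma L2_cmult: "f \<in> L2 T \<Longrightarrow> (\<lambda>x. c * f x) \<in> L2 T"
  by (auto simp: L2_def power_mult_distrib intro!: borel_measurable_times)

lemma L2_continuous:
  assumes e: "continuous_on {0..T} e"
  shows "e \<in> L2 T"
proof -
  have "e \<in> borel_measurable (lebesgue_on {0<..<T})"
    by (rule continuous_imp_measurable_on_sets_lebesgue[OF continuous_on_subset[OF e]]) auto
  moreover have "(\<lambda>x. (e x)\<^sup>2 * 1) absolutely_integrable_on {0<..<T}"
    by (rule L2_mult_continuous(1)[OF L2_const]) (intro continuous_intros e)
  then have "integrable (lebesgue_on {0<..<T}) (\<lambda>x. (e x)\<^sup>2)"
    by (intro absolutely_integrable_imp_integrable) auto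
  ultimately show ?thesis by (simp add: L2_def)
qed

lemma integrable_L2_inner:
  assumes "continuous_on {0..T} e" "f \<in> L2 T"
  shows "integrable (lebesgue_on {0<..<T}) (\<lambda>x. e x * f x)"
  by (rule absolutely_integrable_imp_integrable[OF L2_mult_continuous(1)[OF assms(2,1)]]) auto

lemma L2_inner_closed_interval:
  assumes e: "continuous_on {0..T} e" and f: "f \<in> L2 T"
  shows "integrable (lebesgue_on {0..T}) (\<lambda>x. e x * f x)"
    and "(LINT x|lebesgue_on {0..T}. e x * f x) = L2_inner T e f"
proof -
  show i: "integrable (lebesgue_on {0..T}) (\<lambda>x. e x * f x)"
    by (rule absolutely_integrable_imp_integrable[OF L2_mult_continuous(2)[OF f e]]) auto
  show "(LINT x|lebesgue_on {0..T}. e x * f x) = L2_inner T e f"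
    unfolding L2_inner_def using lebesgue_integral_eq_integral[OF i] lebesgue_integral_eq_integral[OF integrable_L2_inner[OF e f]]
    by (simp add: integral_open_interval_real)
qed

lemma L2_inner_add: "continuous_on {0..T} e \<Longrightarrow> f \<in> L2 T \<Longrightarrow> g \<in> L2 T \<Longrightarrow>
    L2_inner T e (\<lambda>x. f x + g x) = L2_inner T e f + L2_inner T e g"
  unfolding L2_inner_def by (simp add: distrib_left integrable_L2_inner)

lemma L2_inner_cmult: "L2_inner T e (\<lambda>x. c * f x) = c * L2_inner T e f"
  unfolding L2_inner_def by (simp add: mult.left_commute)

lemma L2_inner_cong:
  assumes e: "continuous_on {0..T} e" and "f \<in> L2 T" "g \<in> L2 T" "L2_eq T f g"
  shows "L2_inner T e f = L2_inner T e g"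
  unfolding L2_inner_def
proof (rule integral_cong_AE)
  show "AE x in lebesgue_on {0<..<T}. e x * f x = e x * g x"
    using assms(4) unfolding L2_eq_def by eventually_elim simp
qed (use integrable_L2_inner[OF e] assms(2,3) in auto)

lemma norm_L2_cong: "f \<in> L2 T \<Longrightarrow> g \<in> L2 T \<Longrightarrow> L2_eq T f g \<Longrightarrow> norm_L2 T f = norm_L2 T g"
  unfolding norm_L2_def L2_eq_def
  by (intro arg_cong[where f = sqrt] integral_cong_AE) (auto simp: L2_def elim: eventually_mono)

lemma L2_eqI: "(\<And>x. x \<in> {0<..<T} \<Longrightarrow> f x = g x) \<Longrightarrow> L2_eq T f g"
  unfolding L2_eq_def by (intro AE_I2) simp

lemma L2_eq_sym: "L2_eq T f g \<Longrightarrow> L2_eq T g f"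
  unfolding L2_eq_def by (auto elim: eventually_mono)

lemma L2_eq_trans: "L2_eq T f g \<Longrightarrow> L2_eq T g h \<Longrightarrow> L2_eq T f h"
  unfolding L2_eq_def by (auto elim: eventually_elim2)

text \<open>The Cauchy-Schwarz inequality up to a constant: the quadratic polynomial \<open>x \<mapsto> \<integral> (x e - f)\<^sup>2\<close> is
  nonnegative. Raising its leading coefficient to \<open>\<parallel>e\<parallel>\<^sup>2 + 1\<close> avoids a separate argument for \<open>\<parallel>e\<parallel> = 0\<close>.\<close>
lemma L2_inner_bounded:
  assumes e: "continuous_on {0..T} e"
  shows "\<exists>M\<ge>0. \<forall>f\<in>L2 T. \<bar>L2_inner T e f\<bar> \<le> M * norm_L2 T f"
proof (intro exI conjI ballI)
  define a where "a = L2_inner T e e"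
  have a: "a \<ge> 0" unfolding a_def L2_inner_def by (intro integral_nonneg_AE AE_I2) simp
  show "sqrt (a + 1) \<ge> 0" using a by simp
  fix f assume f: "f \<in> L2 T"
  define b c x where "b = L2_inner T e f" and "c = (LINT x|lebesgue_on {0<..<T}. (f x)\<^sup>2)" and "x = b / (a + 1)"
  have i1: "integrable (lebesgue_on {0<..<T}) (\<lambda>y. e y * e y)" by (rule integrable_L2_inner[OF e L2_continuous[OF e]])
  have i2: "integrable (lebesgue_on {0<..<T}) (\<lambda>y. e y * f y)" by (rule integrable_L2_inner[OF e f])
  have i3: "integrable (lebesgue_on {0<..<T}) (\<lambda>y. (f y)\<^sup>2)" using f by (simp add: L2_def)
  have "0 \<le> (LINT y|lebesgue_on {0<..<T}. (x * e y - f y)\<^sup>2)" by (intro integral_nonneg_AE AE_I2) simp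
  also have "\<dots> = (LINT y|lebesgue_on {0<..<T}. x\<^sup>2 * (e y * e y) - 2 * x * (e y * f y) + (f y)\<^sup>2)"
    by (intro Bochner_Integration.integral_cong refl) (simp add: power2_eq_square algebra_simps)
  also have "\<dots> = x\<^sup>2 * a - 2 * x * b + c"
    using i1 i2 i3 by (simp add: a_def b_def c_def L2_inner_def)
  also have "\<dots> \<le> x\<^sup>2 * (a + 1) - 2 * x * b + c" by (simp add: algebra_simps)
  also have "\<dots> = x * (x * (a + 1)) - 2 * x * b + c" by (simp add: power2_eq_square)
  also have "x * (a + 1) = b" using a by (simp add: x_def)
  finally have "x * b \<le> c" by (simp add: mult.commute)
  then have "(a + 1) * (x * b) \<le> (a + 1) * c" using a by (intro mult_left_mono) auto
  moreover have "(a + 1) * (x * b) = b\<^sup>2" using \<open>x * (a + 1) = b\<close> by (simp add: power2_eq_square mult_ac)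
  ultimately have "b\<^sup>2 \<le> (a + 1) * c" by simp
  then have "sqrt (b\<^sup>2) \<le> sqrt ((a + 1) * c)" by (rule real_sqrt_le_mono)
  then show "\<bar>L2_inner T e f\<bar> \<le> sqrt (a + 1) * norm_L2 T f"
    by (simp add: real_sqrt_mult b_def c_def norm_L2_def)
qed

lemma norm_L2_bounded:
  assumes g: "g \<in> L2 T" and bound: "\<And>x. x \<in> {0<..<T} \<Longrightarrow> \<bar>g x\<bar> \<le> K" and T: "T > 0"
  shows "norm_L2 T g \<le> sqrt T * K"
proof -
  interpret finite_measure "lebesgue_on {0<..<T}"
    by (intro finite_measure_lebesgue_on) auto
  have "K \<ge> 0" using bound[of "T / 2"] T by simp
  have "(LINT x|lebesgue_on {0<..<T}. (g x)\<^sup>2) \<le> (LINT x|lebesgue_on {0<..<T}. K\<^sup>2)"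
  proof (rule integral_mono)
    show "(g x)\<^sup>2 \<le> K\<^sup>2" if "x \<in> space (lebesgue_on {0<..<T})" for x
      using power_mono[OF bound[of x], of 2] that by simp
  qed (use g in \<open>auto simp: L2_def\<close>)
  also have "\<dots> = T * K\<^sup>2"
    using T by (simp add: measure_restrict_space)
  finally have "norm_L2 T g \<le> sqrt (T * K\<^sup>2)"
    unfolding norm_L2_def by (rule real_sqrt_le_mono)
  then show ?thesis using \<open>K \<ge> 0\<close> by (simp add: real_sqrt_mult)
qed

lemma L2_sum:
  assumes "\<And>i. i \<in> I \<Longrightarrow> f i \<in> L2 T"
  shows "(\<lambda>x. \<Sum>i\<in>I. f i x) \<in> L2 T"
  using assms by (induction I rule: infinite_finite_induct) (auto intro: L2_add L2_const)

lemma L2_inner_sum: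
  assumes e: "continuous_on {0..T} e" and f: "\<And>i. i \<in> I \<Longrightarrow> f i \<in> L2 T"
  shows "L2_inner T e (\<lambda>x. \<Sum>i\<in>I. c i * f i x) = (\<Sum>i\<in>I. c i * L2_inner T e (f i))"
  using f
proof (induction I rule: infinite_finite_induct)
  case (insert i I)
  have "L2_inner T e (\<lambda>x. c i * f i x + (\<Sum>i\<in>I. c i * f i x)) = L2_inner T e (\<lambda>x. c i * f i x) + L2_inner T e (\<lambda>x. \<Sum>i\<in>I. c i * f i x)"
    using insert.prems by (intro L2_inner_add e L2_cmult L2_sum) auto
  then show ?case using insert by (simp add: L2_inner_cmult)
qed (simp_all add: L2_inner_def)

section \<open>The fundamental solution of the scalar oscillator equation\<close>

text \<open>The derivative of \<^const>\<open>S\<close> with respect to time.\<close>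
definition S' :: "real \<Rightarrow> real \<Rightarrow> real" where
  "S' t l = (if l > 0 then cos (sqrt l * t) else if l < 0 then cosh (sqrt \<bar>l\<bar> * t) else 1)"

lemma S_0 [simp]: "S 0 l = 0"
  by (simp add: S_def)

lemma S'_0 [simp]: "S' 0 l = 1"
  by (simp add: S'_def)

lemma S_minus: "S (- t) l = - S t l"
  by (simp add: S_def)

lemma S_square: "m > 0 \<Longrightarrow> S t (m\<^sup>2) = sin (m * t) / m" "m > 0 \<Longrightarrow> S t (- m\<^sup>2) = sinh (m * t) / m"
  and S'_square_arg: "m > 0 \<Longrightarrow> S' t (m\<^sup>2) = cos (m * t)" "m > 0 \<Longrightarrow> S' t (- m\<^sup>2) = cosh (m * t)"
  by (simp_all add: S_def S'_def)

text \<open>Writing a nonzero \<open>l\<close> as \<open>\<plusminus> m\<^sup>2\<close> removes the square roots from \<^const>\<open>S\<close>.\<close>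
lemma square_cases:
  fixes l :: real
  obtains (zero) "l = 0" | (pos) m where "m > 0" "l = m\<^sup>2" | (neg) m where "m > 0" "l = - m\<^sup>2"
proof -
  consider "l > 0" | "l < 0" | "l = 0" by linarith
  then show ?thesis
  proof cases
    case 1 then show ?thesis by (intro pos[of "sqrt l"]) auto
  next
    case 2 then show ?thesis by (intro neg[of "sqrt (- l)"]) auto
  qed (rule zero)
qed

lemma has_real_derivative_S:
  assumes "(g has_real_derivative g') (at t within X)"
  shows "((\<lambda>t. S (g t) l) has_real_derivative S' (g t) l * g') (at t within X)"
proof (cases l rule: square_cases)
  case zero
  then show ?thesis using assms by (simp add: S_def S'_def)
qed (auto simp: S_square S'_square_arg intro!: derivative_eq_intros assms)

lemma has_real_derivative_S':
  assumes "(g has_real_derivative g') (at t within X)"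
  shows "((\<lambda>t. S' (g t) l) has_real_derivative - l * S (g t) l * g') (at t within X)"
proof (cases l rule: square_cases)
  case zero
  then show ?thesis by (simp add: S'_def)
next
  case (pos m)
  have "((\<lambda>t. cos (m * g t)) has_real_derivative - m\<^sup>2 * (sin (m * g t) / m) * g') (at t within X)"
    using pos by (auto intro!: derivative_eq_intros assms simp: power2_eq_square)
  then show ?thesis using pos by (simp add: S_square S'_square_arg)
next
  case (neg m)
  have "((\<lambda>t. cosh (m * g t)) has_real_derivative m\<^sup>2 * (sinh (m * g t) / m) * g') (at t within X)"
    using neg by (auto intro!: derivative_eq_intros assms simp: power2_eq_square)
  then show ?thesis using neg by (simp add: S_square S'_square_arg)
qed

lemma S_add: "S (a + b) l = S a l * S' b l + S' a l * S b l"
proof -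
  consider "l > 0" | "l < 0" | "l = 0" by linarith
  then show ?thesis
    by cases (simp_all add: S_def S'_def distrib_left sin_add sinh_add add_divide_distrib)
qed

lemma S'_add: "S' (a + b) l = S' a l * S' b l - l * S a l * S b l"
proof -
  consider "l > 0" | "l < 0" | "l = 0" by linarith
  then show ?thesis
    by cases (simp_all add: S_def S'_def distrib_left cos_add cosh_add)
qed

lemma S'_minus: "S' (- t) l = S' t l"
  by (simp add: S'_def)

lemma S'_square: "(S' t l)\<^sup>2 + l * (S t l)\<^sup>2 = 1"
  using S'_add[of t "- t" l] by (simp add: S_minus S'_minus power2_eq_square mult.assoc)

text \<open>The primitive of \<^const>\<open>S\<close> vanishing at \<open>0\<close>. For \<open>l > 0\<close> it is \<open>(1 - cos (sqrt l * t)) / l\<close>; the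
  half-angle form needs no case distinction on the sign of \<open>l\<close>.\<close>
definition S_prim :: "real \<Rightarrow> real \<Rightarrow> real" where
  "S_prim t l = 2 * (S (t / 2) l)\<^sup>2"

lemma S_prim_0 [simp]: "S_prim 0 l = 0"
  by (simp add: S_prim_def)

lemma has_real_derivative_S_prim: "((\<lambda>t. S_prim t l) has_real_derivative S t l) (at t within X)"
proof -
  have "S t l = 2 * S (t / 2) l * S' (t / 2) l"
    using S_add[of "t / 2" "t / 2" l] by simp
  then show ?thesis unfolding S_prim_def
    by (auto intro!: derivative_eq_intros has_real_derivative_S)
qed

lemma S'_plus_S_prim: "S' t l + l * S_prim t l = 1"
  using S'_add[of "t / 2" "t / 2" l] S'_square[of "t / 2" l]
  by (simp add: S_prim_def power2_eq_square algebra_simps)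

text \<open>The product formula for sines, for all signs of \<open>l\<close> at once. It is what separates the kernel of the
  connecting operator.\<close>
lemma S_prim_diff: "S_prim (x + y) l - S_prim (x - y) l = 2 * S x l * S y l"
proof -
  define p q where "p = (x + y) / 2" and "q = (x - y) / 2"
  have xy: "x = p + q" "y = p + (- q)" by (simp_all add: p_def q_def field_simps)
  have "(S p l)\<^sup>2 - (S q l)\<^sup>2 = (S p l)\<^sup>2 * ((S' q l)\<^sup>2 + l * (S q l)\<^sup>2) - ((S' p l)\<^sup>2 + l * (S p l)\<^sup>2) * (S q l)\<^sup>2"
    by (simp add: S'_square)
  also have "\<dots> = S x l * S y l"
    unfolding xy S_add S_minus S'_minus by (simp add: algebra_simps power2_eq_square)
  finally show ?thesis by (simp add: S_prim_def p_def q_def)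
qed

lemma S_prim_abs: "S_prim \<bar>t\<bar> l = S_prim t l"
  by (simp add: S_prim_def abs_if S_minus)

lemma continuous_on_S [continuous_intros]: "continuous_on X g \<Longrightarrow> continuous_on X (\<lambda>t. S (g t) l)"
proof -
  have "continuous_on UNIV (\<lambda>t. S t l)"
    by (rule DERIV_continuous_on) (rule has_real_derivative_S[OF DERIV_ident])
  then show "continuous_on X g \<Longrightarrow> continuous_on X (\<lambda>t. S (g t) l)"
    by (rule continuous_on_compose2) auto
qed

lemma continuous_on_S' [continuous_intros]: "continuous_on X g \<Longrightarrow> continuous_on X (\<lambda>t. S' (g t) l)"
proof -
  have "continuous_on UNIV (\<lambda>t. S' t l)"
    by (rule DERIV_continuous_on) (rule has_real_derivative_S'[OF DERIV_ident])
  then show "continuous_on X g \<Longrightarrow> continuous_on X (\<lambda>t. S' (g t) l)"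
    by (rule continuous_on_compose2) auto
qed

lemma has_integral_S: "a \<le> b \<Longrightarrow> ((\<lambda>t. S t l) has_integral S_prim b l - S_prim a l) {a..b}"
  using has_real_derivative_S_prim[of l]
  by (intro fundamental_theorem_of_calculus) (auto simp: has_real_derivative_iff_has_vector_derivative[symmetric])

text \<open>Differentiating a vanishing combination twice multiplies its coefficients by \<open>- l k\<close>; a multiple of the
  original relation may then be added.\<close>
lemma sum_S_annihilated_shift:
  fixes c l :: "nat \<Rightarrow> real"
  assumes zero: "\<And>x. x \<in> {0<..<T} \<Longrightarrow> (\<Sum>k<N. c k * S x (l k)) = 0" and x: "x \<in> {0<..<T}"
  shows "(\<Sum>k<N. c k * S' x (l k)) = 0" "(\<Sum>k<N. c k * (l k - \<mu>) * S x (l k)) = 0"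
proof -
  have 1: "(\<Sum>k<N. c k * S' x (l k)) = 0" if x: "x \<in> {0<..<T}" for x
  proof -
    have "((\<lambda>x. \<Sum>k<N. c k * S x (l k)) has_real_derivative (\<Sum>k<N. c k * S' x (l k))) (at x)"
      by (auto intro!: derivative_eq_intros has_real_derivative_S simp: mult_ac)
    then have "((\<lambda>x. 0) has_real_derivative (\<Sum>k<N. c k * S' x (l k))) (at x)"
      by (rule has_field_derivative_transform_within_open[of _ _ _ "{0<..<T}"]) (use x zero in auto)
    then show ?thesis using DERIV_unique DERIV_const by blast
  qed
  show "(\<Sum>k<N. c k * S' x (l k)) = 0" by (rule 1[OF x])
  have "((\<lambda>x. \<Sum>k<N. c k * S' x (l k)) has_real_derivative (\<Sum>k<N. c k * (- l k * S x (l k)))) (at x)"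
    by (auto intro!: derivative_eq_intros has_real_derivative_S' simp: mult_ac)
  then have "((\<lambda>x. 0) has_real_derivative (\<Sum>k<N. c k * (- l k * S x (l k)))) (at x)"
    by (rule has_field_derivative_transform_within_open[of _ _ _ "{0<..<T}"]) (use x 1 in auto)
  then have 2: "(\<Sum>k<N. c k * (- l k * S x (l k))) = 0" using DERIV_unique DERIV_const by blast
  have "(\<Sum>k<N. c k * (l k - \<mu>) * S x (l k)) = - (\<Sum>k<N. c k * (- l k * S x (l k))) - \<mu> * (\<Sum>k<N. c k * S x (l k))"
    by (simp add: sum_negf[symmetric] sum_distrib_left sum_subtractf[symmetric] algebra_simps)
  then show "(\<Sum>k<N. c k * (l k - \<mu>) * S x (l k)) = 0" using 2 zero[OF x] by simp
qed

text \<open>Shifting by all \<open>l j\<close> with \<open>j \<noteq> i\<close> in turn kills every term but the one with index \<open>i\<close>, as in Lagrange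
  interpolation. Since \<^const>\<open>S\<close> and its derivative have no common zero, the surviving coefficient vanishes.\<close>
lemma S_linearly_independent:
  fixes c l :: "nat \<Rightarrow> real"
  assumes inj: "inj_on l {..<N}" and T: "T > 0"
    and zero: "\<And>x. x \<in> {0<..<T} \<Longrightarrow> (\<Sum>k<N. c k * S x (l k)) = 0" and i: "i < N"
  shows "c i = 0"
proof -
  have prod: "finite J \<Longrightarrow> \<forall>x\<in>{0<..<T}. (\<Sum>k<N. (c k * (\<Prod>j\<in>J. (l k - l j))) * S x (l k)) = 0" for J
  proof (induction J rule: finite_induct)
    case (insert a J)
    have "(\<Sum>k<N. (c k * (\<Prod>j\<in>J. (l k - l j))) * (l k - l a) * S x (l k)) = 0" if "x \<in> {0<..<T}" for x
      using insert.IH that by (intro sum_S_annihilated_shift(2)[of T]) auto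
    then show ?case using insert.hyps by (simp add: mult_ac)
  qed (use zero in simp)
  let ?J = "{..<N} - {i}"
  define d where "d k = c k * (\<Prod>j\<in>?J. (l k - l j))" for k
  have dz: "(\<Sum>k<N. d k * S x (l k)) = 0" if "x \<in> {0<..<T}" for x
    using prod[of ?J] that by (simp add: d_def)
  have d0: "d k = 0" if "k < N" "k \<noteq> i" for k
    using that by (auto simp: d_def intro!: prod_zero)
  have single: "(\<Sum>k<N. d k * s k) = d i * s i" for s :: "nat \<Rightarrow> real"
  proof -
    have "(\<Sum>k<N. d k * s k) = (\<Sum>k<N. if k = i then d i * s i else 0)"
      by (intro sum.cong refl) (auto simp: d0)
    then show ?thesis using i by simp
  qed
  have half: "T / 2 \<in> {0<..<T}" using T by simp
  have "d i * S (T / 2) (l i) = 0" "d i * S' (T / 2) (l i) = 0"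
    using dz[OF half] sum_S_annihilated_shift(1)[OF dz half] unfolding single by auto
  then have "d i = 0"
    using S'_square[of "T / 2" "l i"] by auto
  moreover have "(\<Prod>j\<in>?J. (l i - l j)) \<noteq> 0"
    using inj i by (auto simp: inj_on_def)
  ultimately show ?thesis by (simp add: d_def)
qed

section \<open>The response function in terms of spectral data\<close>

text \<open>The column \<open>\<lambda>j. p j k\<close> is an eigenvector for \<open>l k\<close>, normalized to have first entry \<open>1\<close>, and
  the last condition is the expansion of the first unit vector in these eigenvectors. Thus \<open>m k\<close> is the
  square of the first entry of the unit eigenvector, and \<open>p j\<close> are the values at the eigenvalues of the
  orthonormal polynomials of the measure \<open>\<Sum>\<^sub>k m\<^sub>k \<delta>(l k)\<close>.\<close>
definition spectral_data :: "nat \<Rightarrow> real mat \<Rightarrow> (nat \<Rightarrow> real) \<Rightarrow> (nat \<Rightarrow> real) \<Rightarrow> (nat \<Rightarrow> nat \<Rightarrow> real) \<Rightarrow> bool" where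
  "spectral_data N A l m p \<longleftrightarrow>
     (\<forall>i<N. \<forall>k<N. (\<Sum>j<N. A $$ (i, j) * p j k) = l k * p i k) \<and>
     (\<forall>k<N. p 0 k = 1) \<and>
     (\<forall>i<N. (\<Sum>k<N. m k * p i k) = (if i = 0 then 1 else 0))"

definition spectral_response :: "nat \<Rightarrow> (nat \<Rightarrow> real) \<Rightarrow> (nat \<Rightarrow> real) \<Rightarrow> real \<Rightarrow> real" where
  "spectral_response N l m t = (\<Sum>k<N. m k * S t (l k))"

lemma sum_matrix_spectral:
  assumes "spectral_data N A l m p" "i < N"
  shows "(\<Sum>j<N. A $$ (i, j) * (\<Sum>k<N. m k * p j k * x k)) = (\<Sum>k<N. m k * p i k * (l k * x k))"
proof -
  have "(\<Sum>j<N. A $$ (i, j) * (\<Sum>k<N. m k * p j k * x k)) = (\<Sum>j<N. \<Sum>k<N. m k * x k * (A $$ (i, j) * p j k))"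
    by (simp add: sum_distrib_left mult_ac)
  also have "\<dots> = (\<Sum>k<N. \<Sum>j<N. m k * x k * (A $$ (i, j) * p j k))"
    by (rule sum.swap)
  also have "\<dots> = (\<Sum>k<N. m k * x k * (l k * p i k))"
    using assms by (simp add: sum_distrib_left[symmetric] spectral_data_def)
  finally show ?thesis by (simp add: mult_ac)
qed

lemma index_mult_mat_vec_sum:
  assumes "A \<in> carrier_mat N N" "u \<in> carrier_vec N" "i < N"
  shows "(A *\<^sub>v u) $ i = (\<Sum>j<N. A $$ (i, j) * u $ j)"
  using assms by (simp add: scalar_prod_def atLeast0LessThan)

text \<open>Duhamel's principle. Let \<open>R i\<close> be the \<open>i\<close>-th component of the solution of the homogeneous system that starts at
  \<open>0\<close> with velocity the first unit vector. Pairing it, run backwards from time \<open>t\<close>, with a solution \<open>(u, v)\<close>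
  gives \<open>g(s) = \<Sum>\<^sub>i R i (t - s) v\<^sub>i(s) + R' i (t - s) u\<^sub>i(s)\<close>, whose derivative is \<open>R 0 (t - s) f(s)\<close> by symmetry of the matrix. Since
  \<open>g(0) = 0\<close> and \<open>g(t)\<close> is the first entry of \<open>u(t)\<close>, integrating proves the formula.\<close>
lemma response_of_solution:
  assumes jac: "jacobi_matrix N A" and N: "N \<ge> 1" and sp: "spectral_data N A l m p"
    and f: "locally_L2 f" and sol: "is_solution N A f u" and t: "t > 0"
  shows "u t $ 0 = (LINT s|lebesgue_on {0..t}. spectral_response N l m (t - s) * f s)"
proof -
  have A: "A \<in> carrier_mat N N" and sym: "\<And>i j. i < N \<Longrightarrow> j < N \<Longrightarrow> A $$ (i, j) = A $$ (j, i)"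
    using jac by (auto simp: jacobi_matrix_def)
  have p0: "p 0 k = 1" if "k < N" for k using sp that by (simp add: spectral_data_def)
  have pm: "(\<Sum>k<N. m k * p i k) = (if i = 0 then 1 else 0)" if "i < N" for i
    using sp that by (simp add: spectral_data_def)
  define R where "R i s = (\<Sum>k<N. m k * p i k * S s (l k))" for i s
  define R' where "R' i s = (\<Sum>k<N. m k * p i k * S' s (l k))" for i s
  have R0: "R 0 s = spectral_response N l m s" for s
    by (simp add: R_def spectral_response_def p0)
  have dR: "((\<lambda>s. R i (t - s)) has_real_derivative - R' i (t - s)) (at s within X)" for i s X
    unfolding R_def R'_def
    by (auto intro!: derivative_eq_intros has_real_derivative_S simp: sum_negf[symmetric] mult_ac)
  have dR': "((\<lambda>s. R' i (t - s)) has_real_derivative (\<Sum>j<N. A $$ (i, j) * R j (t - s))) (at s within X)"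
    if "i < N" for i s X
    unfolding R_def R'_def sum_matrix_spectral[OF sp that]
    by (auto intro!: derivative_eq_intros has_real_derivative_S' simp: mult_ac)
  have contR: "continuous_on X (\<lambda>s. R i (t - s))" and contR': "continuous_on X (\<lambda>s. R' i (t - s))" for X i
    unfolding R_def R'_def by (intro continuous_intros)+
  obtain v where uvc: "\<And>s. s \<ge> 0 \<Longrightarrow> u s \<in> carrier_vec N \<and> v s \<in> carrier_vec N"
    and acu: "\<And>i X. i < N \<Longrightarrow> X > 0 \<Longrightarrow> abs_continuous_on 0 X (\<lambda>t. u t $ i)"
    and acv: "\<And>i X. i < N \<Longrightarrow> X > 0 \<Longrightarrow> abs_continuous_on 0 X (\<lambda>t. v t $ i)"
    and du: "\<And>i t. i < N \<Longrightarrow> t \<ge> 0 \<Longrightarrow> ((\<lambda>s. u s $ i) has_real_derivative v t $ i) (at t within {0..})"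
    and u0: "u 0 = 0\<^sub>v N" and v0: "v 0 = 0\<^sub>v N"
    and ae: "AE t in lebesgue. t > 0 \<longrightarrow> (\<exists>w \<in> carrier_vec N.
                (\<forall>i<N. ((\<lambda>s. v s $ i) has_real_derivative w $ i) (at t)) \<and>
                w + A *\<^sub>v u t = f t \<cdot>\<^sub>v unit_vec N 0)"
    using sol unfolding is_solution_def by blast
  define g where "g s = (\<Sum>i<N. R i (t - s) * v s $ i + R' i (t - s) * u s $ i)" for s
  let ?h = "\<lambda>s. spectral_response N l m (t - s) * f s"
  \<comment> \<open>The terms with \<open>R' i (t - s) * v s $ i\<close> cancel; the others combine by symmetry of \<open>A\<close>.\<close>
  have deriv: "(g has_real_derivative ?h s) (at s)"
    if s: "s > 0" and w: "w \<in> carrier_vec N" and dv: "\<And>i. i < N \<Longrightarrow> ((\<lambda>s. v s $ i) has_real_derivative w $ i) (at s)"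
      and eq: "w + A *\<^sub>v u s = f s \<cdot>\<^sub>v unit_vec N 0" for s w
  proof -
    have dus: "((\<lambda>s. u s $ i) has_real_derivative v s $ i) (at s)" if "i < N" for i
    proof -
      have "s \<in> interior {0..}" using s by (simp add: interior_real_atLeast)
      then have "at s within {0..} = at s" by (rule at_within_interior)
      then show ?thesis using du[OF that, of s] s by simp
    qed
    have comp: "w $ i + (\<Sum>j<N. A $$ (i, j) * u s $ j) = (if i = 0 then f s else 0)" if i: "i < N" for i
    proof -
      have "(w + A *\<^sub>v u s) $ i = (f s \<cdot>\<^sub>v unit_vec N 0) $ i" using eq by simp
      then show ?thesis using i w A uvc[of s] s N
        by (simp add: index_mult_mat_vec_sum[symmetric] del: index_mult_mat_vec)
    qed
    have "(g has_real_derivative (\<Sum>i<N. (- R' i (t - s) * v s $ i + R i (t - s) * w $ i) +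
             ((\<Sum>j<N. A $$ (i, j) * R j (t - s)) * u s $ i + R' i (t - s) * v s $ i))) (at s)"
      unfolding g_def
    proof (rule DERIV_sum)
      fix i assume "i \<in> {..<N}"
      then have i: "i < N" by simp
      show "((\<lambda>s. R i (t - s) * v s $ i + R' i (t - s) * u s $ i) has_real_derivative
          (- R' i (t - s) * v s $ i + R i (t - s) * w $ i) +
             ((\<Sum>j<N. A $$ (i, j) * R j (t - s)) * u s $ i + R' i (t - s) * v s $ i)) (at s)"
        using DERIV_mult'[OF dR[of i s UNIV] dv[OF i]] DERIV_mult'[OF dR'[OF i, of s UNIV] dus[OF i]]
        by (rule DERIV_cong[OF DERIV_add]) (simp add: algebra_simps)
    qed
    also have "(\<Sum>i<N. (- R' i (t - s) * v s $ i + R i (t - s) * w $ i) +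
             ((\<Sum>j<N. A $$ (i, j) * R j (t - s)) * u s $ i + R' i (t - s) * v s $ i)) =
          (\<Sum>i<N. R i (t - s) * w $ i) + (\<Sum>i<N. \<Sum>j<N. R j (t - s) * (A $$ (i, j) * u s $ i))"
      by (simp add: sum.distrib sum_distrib_right sum_distrib_left mult_ac sum_negf)
    also have "(\<Sum>i<N. \<Sum>j<N. R j (t - s) * (A $$ (i, j) * u s $ i)) = (\<Sum>j<N. \<Sum>i<N. R j (t - s) * (A $$ (i, j) * u s $ i))"
      by (rule sum.swap)
    also have "\<dots> = (\<Sum>j<N. R j (t - s) * (\<Sum>i<N. A $$ (j, i) * u s $ i))"
      unfolding sum_distrib_left by (intro sum.cong refl) (simp add: sym)
    also have "(\<Sum>i<N. R i (t - s) * w $ i) + (\<Sum>j<N. R j (t - s) * (\<Sum>i<N. A $$ (j, i) * u s $ i)) =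
        (\<Sum>i<N. R i (t - s) * (w $ i + (\<Sum>j<N. A $$ (i, j) * u s $ j)))"
      by (simp add: sum.distrib distrib_left)
    also have "\<dots> = (\<Sum>i<N. if i = 0 then R i (t - s) * f s else 0)"
      by (intro sum.cong refl) (simp add: comp)
    also have "\<dots> = ?h s"
      using N by (simp add: sum.delta R0)
    finally show ?thesis .
  qed
  have "abs_continuous_on 0 t (\<lambda>s. R i (t - s) * v s $ i + R' i (t - s) * u s $ i)" if "i < N" for i
  proof -
    have "abs_continuous_on 0 t (\<lambda>s. R i (t - s))"
      by (rule abs_continuous_on_C1[OF dR]) (intro continuous_intros contR')
    moreover have "abs_continuous_on 0 t (\<lambda>s. R' i (t - s))"
      by (rule abs_continuous_on_C1[OF dR'[OF that]]) (intro continuous_intros contR)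
    ultimately show ?thesis using acu[OF that t] acv[OF that t]
      by (intro abs_continuous_on_add abs_continuous_on_mult)
  qed
  then have "abs_continuous_on 0 t g"
    unfolding g_def by (intro abs_continuous_on_sum) auto
  moreover have "AE s in lebesgue. s \<in> {0<..<t} \<longrightarrow> (g has_real_derivative ?h s) (at s)"
    using ae by eventually_elim (use deriv in auto)
  ultimately have hi: "(?h has_integral g t - g 0) {0..t}"
    using t by (intro abs_continuous_fundamental_theorem)
  have "g t = (\<Sum>i<N. if i = 0 then u t $ 0 else 0)"
    unfolding g_def by (intro sum.cong refl) (simp add: R_def R'_def pm)
  also have "\<dots> = u t $ 0" using N by (simp add: sum.delta)
  finally have gt: "g t = u t $ 0" .
  have g0: "g 0 = 0" by (simp add: g_def u0 v0)
  have "?h absolutely_integrable_on {0..t}"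
    using f t contR[of _ 0] unfolding R0 by (intro L2_mult_continuous) (auto simp: locally_L2_def)
  then have "integrable (lebesgue_on {0..t}) ?h"
    by (intro absolutely_integrable_imp_integrable) auto
  then have "(LINT s|lebesgue_on {0..t}. ?h s) = integral {0..t} ?h"
    by (intro lebesgue_integral_eq_integral) auto
  then show ?thesis using integral_unique[OF hi] gt g0 by simp
qed

text \<open>For the constant control the convolution is a primitive of \<^const>\<open>S\<close>, so a smooth solution can be
  written down.\<close>
lemma spectral_solution_constant_control:
  assumes jac: "jacobi_matrix N A" and N: "N \<ge> 1" and sp: "spectral_data N A l m p"
  shows "is_solution N A (\<lambda>_. 1) (\<lambda>t. vec N (\<lambda>i. \<Sum>k<N. m k * p i k * S_prim t (l k)))"
proof -
  have A: "A \<in> carrier_mat N N" using jac by (auto simp: jacobi_matrix_def)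
  define U where "U i t = (\<Sum>k<N. m k * p i k * S_prim t (l k))" for i t
  define V where "V i t = (\<Sum>k<N. m k * p i k * S t (l k))" for i t
  define W where "W i t = (\<Sum>k<N. m k * p i k * S' t (l k))" for i t
  have dU: "(U i has_real_derivative V i t) (at t within X)" for i t X
    unfolding U_def V_def by (auto intro!: derivative_eq_intros has_real_derivative_S_prim simp: mult_ac)
  have dV: "(V i has_real_derivative W i t) (at t within X)" for i t X
    unfolding V_def W_def by (auto intro!: derivative_eq_intros has_real_derivative_S simp: mult_ac)
  have contV: "continuous_on X (V i)" and contW: "continuous_on X (W i)" for X i
    unfolding V_def W_def by (intro continuous_intros)+
  have eq: "W i t + (\<Sum>j<N. A $$ (i, j) * U j t) = (if i = 0 then 1 else 0)" if "i < N" for i t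
  proof -
    have "W i t + (\<Sum>j<N. A $$ (i, j) * U j t) = (\<Sum>k<N. m k * p i k * (S' t (l k) + l k * S_prim t (l k)))"
      unfolding U_def W_def sum_matrix_spectral[OF sp that] by (simp add: distrib_left sum.distrib)
    also have "\<dots> = (\<Sum>k<N. m k * p i k)" by (simp add: S'_plus_S_prim)
    finally show ?thesis using sp that by (simp add: spectral_data_def)
  qed
  have "vec N (\<lambda>i. W i t) + A *\<^sub>v vec N (\<lambda>i. U i t) = 1 \<cdot>\<^sub>v unit_vec N 0" for t
  proof (rule eq_vecI)
    fix i assume "i < dim_vec ((1::real) \<cdot>\<^sub>v unit_vec N 0)"
    then have i: "i < N" by simp
    have "(A *\<^sub>v vec N (\<lambda>i. U i t)) $ i = (\<Sum>j<N. A $$ (i, j) * U j t)"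
      by (subst index_mult_mat_vec_sum[OF A _ i]) auto
    then show "(vec N (\<lambda>i. W i t) + A *\<^sub>v vec N (\<lambda>i. U i t)) $ i = (1 \<cdot>\<^sub>v unit_vec N 0) $ i"
      using eq[OF i, of t] i A by (simp add: unit_vec_def)
  qed (use A in auto)
  then have "\<exists>w\<in>carrier_vec N. (\<forall>i<N. (V i has_real_derivative w $ i) (at t)) \<and>
      w + A *\<^sub>v vec N (\<lambda>i. U i t) = 1 \<cdot>\<^sub>v unit_vec N 0" for t
    using dV by (intro bexI[of _ "vec N (\<lambda>i. W i t)"]) auto
  moreover have "vec N (\<lambda>i. U i 0) = 0\<^sub>v N" "vec N (\<lambda>i. V i 0) = 0\<^sub>v N"
    by (auto simp: U_def V_def)
  moreover have "abs_continuous_on 0 X (U i)" "abs_continuous_on 0 X (V i)" for X i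
    by (rule abs_continuous_on_C1, rule dU, rule contV) (rule abs_continuous_on_C1, rule dV, rule contW)
  ultimately have "is_solution N A (\<lambda>_. 1) (\<lambda>t. vec N (\<lambda>i. U i t))"
    unfolding is_solution_def using dU by (intro exI[of _ "\<lambda>t. vec N (\<lambda>i. V i t)"]) auto
  then show ?thesis by (simp add: U_def)
qed

text \<open>For the forward direction one control suffices: with \<open>f = 1\<close> the primitives of \<open>r\<close> and of
  the spectral response agree, hence so do the functions, both being continuous.\<close>
theorem is_response_function_iff:
  assumes jac: "jacobi_matrix N A" and N: "N \<ge> 1" and sp: "spectral_data N A l m p" and T: "T > 0"
  shows "is_response_function N A T r \<longleftrightarrow> (\<forall>t\<in>{0..2 * T}. r t = spectral_response N l m t)"
proof
  assume r: "\<forall>t\<in>{0..2 * T}. r t = spectral_response N l m t"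
  have "continuous_on {0..2 * T} (spectral_response N l m)"
    unfolding spectral_response_def by (intro continuous_intros)
  then have "continuous_on {0..2 * T} r"
    by (rule continuous_on_eq) (use r in auto)
  moreover have "u t $ 0 = (LINT s|lebesgue_on {0..t}. r (t - s) * f s)"
    if "locally_L2 f" "is_solution N A f u" "t \<in> {0..2 * T}" for f u t
  proof (cases "t = 0")
    case True
    have "u 0 $ 0 = 0" using that N by (auto simp: is_solution_def)
    moreover have "(LINT s|lebesgue_on {0..0}. r (0 - s) * f s) = 0"
    proof (rule integral_eq_zero_AE)
      have "{0} \<in> null_sets (lebesgue_on {0..0::real})" by (simp add: null_sets_restrict_space)
      then show "AE x in lebesgue_on {0..0}. r (0 - x) * f x = 0"
        by (rule AE_I') auto
    qed
    ultimately show ?thesis using True by simp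
  next
    case False
    then have "t > 0" using that by simp
    then have "u t $ 0 = (LINT s|lebesgue_on {0..t}. spectral_response N l m (t - s) * f s)"
      using that by (intro response_of_solution[OF jac N sp]) auto
    also have "\<dots> = (LINT s|lebesgue_on {0..t}. r (t - s) * f s)"
      using r that by (intro Bochner_Integration.integral_cong) auto
    finally show ?thesis .
  qed
  ultimately show "is_response_function N A T r"
    by (auto simp: is_response_function_def)
next
  assume resp: "is_response_function N A T r"
  then have cont: "continuous_on {0..2 * T} r" by (simp add: is_response_function_def)
  have p0: "p 0 k = 1" if "k < N" for k using sp that by (simp add: spectral_data_def)
  have L: "locally_L2 (\<lambda>_. 1)" by (simp add: locally_L2_def L2_const)
  define Q where "Q t = (\<Sum>k<N. m k * S_prim t (l k))" for t
  have Q: "Q t = integral {0..t} r" if t: "t \<in> {0..2 * T}" for t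
  proof -
    have ct: "continuous_on {0..t} (\<lambda>s. r (t - s))"
      using t by (intro continuous_on_compose2[OF cont]) (auto intro!: continuous_intros)
    have "Q t = vec N (\<lambda>i. \<Sum>k<N. m k * p i k * S_prim t (l k)) $ 0"
      using N by (simp add: Q_def p0)
    also have "\<dots> = (LINT s|lebesgue_on {0..t}. r (t - s) * 1)"
      using resp L spectral_solution_constant_control[OF jac N sp] t
      unfolding is_response_function_def by fast
    also have "\<dots> = integral {0..t} (\<lambda>s. r (t - s))"
      using absolutely_integrable_continuous_real[OF ct]
      by (simp add: lebesgue_integral_eq_integral absolutely_integrable_imp_integrable)
    also have "\<dots> = integral {0..t} r"
    proof -
      have "(r has_integral integral {0..t} r) (cbox 0 t)"
        using t integrable_continuous_real[OF continuous_on_subset[OF cont]] by (simp add: integrable_integral)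
      \<comment> \<open>Reflection at the midpoint of the interval.\<close>
      from has_integral_affinity[OF this, of "-1" t]
      have "((\<lambda>s. r (t - s)) has_integral integral {0..t} r) {0..t}" using t by simp
      then show ?thesis by (rule integral_unique)
    qed
    finally show ?thesis .
  qed
  show "\<forall>t\<in>{0..2 * T}. r t = spectral_response N l m t"
  proof
    fix t assume t: "t \<in> {0..2 * T}"
    have "((\<lambda>t. integral {0..t} r) has_real_derivative r t) (at t within {0..2 * T})"
      by (rule integral_has_real_derivative[OF cont t])
    then have "(Q has_real_derivative r t) (at t within {0..2 * T})"
      by (rule has_field_derivative_transform_within[where d = 1]) (use t Q in auto)
    moreover have "(Q has_real_derivative spectral_response N l m t) (at t within {0..2 * T})"
      unfolding Q_def spectral_response_def by (auto intro!: derivative_eq_intros has_real_derivative_S_prim simp: mult_ac)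
    moreover have "at t within {0..2 * T} \<noteq> bot"
      using t T by (simp add: trivial_limit_within)
    ultimately show "r t = spectral_response N l m t"
      by (rule has_field_derivative_unique)
  qed
qed

section \<open>Spectral data of a Jacobi matrix\<close>

text \<open>A one-sided inverse of a square matrix is two-sided. This turns orthogonality of
  eigenvectors into orthonormality of polynomials, and back.\<close>
lemma orthonormal_rows_imp_columns:
  fixes Q :: "nat \<Rightarrow> nat \<Rightarrow> real"
  assumes rows: "\<And>i k. i < N \<Longrightarrow> k < N \<Longrightarrow> (\<Sum>j<N. Q i j * Q k j) = (if i = k then 1 else 0)"
    and "i < N" "j < N"
  shows "(\<Sum>k<N. Q k i * Q k j) = (if i = j then 1 else 0)"
proof -
  define M where "M = mat N N (\<lambda>(i, j). Q i j)"
  have M: "M \<in> carrier_mat N N" "transpose_mat M \<in> carrier_mat N N" by (auto simp: M_def)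
  have "M * transpose_mat M = 1\<^sub>m N"
    by (rule eq_matI) (auto simp: M_def scalar_prod_def atLeast0LessThan rows)
  then have "transpose_mat M * M = 1\<^sub>m N"
    using mat_mult_left_right_inverse[OF M] by simp
  then have "(transpose_mat M * M) $$ (i, j) = 1\<^sub>m N $$ (i, j)" by simp
  then show ?thesis using assms(2,3)
    by (simp add: M_def scalar_prod_def atLeast0LessThan)
qed

text \<open>The orthogonal polynomials of the matrix with diagonal \<open>b\<close> and off-diagonal \<open>a\<close>. They have real
  coefficients, but live over the complex numbers so that the last one splits into linear factors.\<close>
fun jacobi_poly :: "(nat \<Rightarrow> real) \<Rightarrow> (nat \<Rightarrow> real) \<Rightarrow> nat \<Rightarrow> complex poly" where
  "jacobi_poly a b 0 = 1"
| "jacobi_poly a b (Suc n) = Polynomial.smult (1 / of_real (a n)) ([:- of_real (b n), 1:] * jacobi_poly a b n -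
     (if n = 0 then 0 else Polynomial.smult (of_real (a (n - 1))) (jacobi_poly a b (n - 1))))"

lemma jacobi_poly_rec:
  assumes "a n \<noteq> 0"
  shows "Polynomial.smult (of_real (a n)) (jacobi_poly a b (Suc n)) = [:- of_real (b n), 1:] * jacobi_poly a b n -
     (if n = 0 then 0 else Polynomial.smult (of_real (a (n - 1))) (jacobi_poly a b (n - 1)))"
  using assms by simp

lemma poly_jacobi_poly_rec:
  assumes "a n \<noteq> 0"
  shows "of_real (a n) * poly (jacobi_poly a b (Suc n)) z = (z - of_real (b n)) * poly (jacobi_poly a b n) z -
     (if n = 0 then 0 else of_real (a (n - 1)) * poly (jacobi_poly a b (n - 1)) z)"
  using arg_cong[OF jacobi_poly_rec[of a n b, OF assms], of "\<lambda>p. poly p z"]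
  by (cases "n = 0") (simp_all add: algebra_simps del: jacobi_poly.simps)

lemma poly_pderiv_jacobi_poly_rec:
  assumes "a n \<noteq> 0"
  shows "of_real (a n) * poly (pderiv (jacobi_poly a b (Suc n))) z =
     poly (jacobi_poly a b n) z + (z - of_real (b n)) * poly (pderiv (jacobi_poly a b n)) z -
     (if n = 0 then 0 else of_real (a (n - 1)) * poly (pderiv (jacobi_poly a b (n - 1))) z)"
  using arg_cong[OF jacobi_poly_rec[of a n b, OF assms], of "\<lambda>p. poly (pderiv p) z"]
  by (auto simp: pderiv_smult pderiv_mult pderiv_diff pderiv_add pderiv_pCons algebra_simps simp del: jacobi_poly.simps mult_pCons_left split: if_splits)

lemma cnj_poly_jacobi_poly: "poly (jacobi_poly a b n) (cnj z) = cnj (poly (jacobi_poly a b n) z)"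
  by (induction a b n rule: jacobi_poly.induct) auto

lemma degree_jacobi_poly:
  assumes a: "\<And>n. a n > 0"
  shows "jacobi_poly a b n \<noteq> 0 \<and> degree (jacobi_poly a b n) = n"
proof (induction n rule: less_induct)
  case (less n)
  show ?case
  proof (cases n)
    case (Suc k)
    have k: "jacobi_poly a b k \<noteq> 0" "degree (jacobi_poly a b k) = k" using less[of k] Suc by auto
    let ?s = "if k = 0 then 0 else Polynomial.smult (of_real (a (k - 1))) (jacobi_poly a b (k - 1))"
    have d1: "degree ([:- of_real (b k), 1:] * jacobi_poly a b k) = Suc k"
      using k by (subst degree_mult_eq) auto
    have d2: "degree ?s < Suc k"
    proof (cases "k = 0")
      case False
      then have "degree (jacobi_poly a b (k - 1)) = k - 1" using less[of "k - 1"] Suc by auto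
      then show ?thesis using False
        using degree_smult_le[of "complex_of_real (a (k - 1))" "jacobi_poly a b (k - 1)"] by simp
    qed simp
    have d: "degree ([:- of_real (b k), 1:] * jacobi_poly a b k - ?s) = Suc k"
      using degree_add_eq_left[of "- ?s" "[:- of_real (b k), 1:] * jacobi_poly a b k"] d1 d2 by simp
    then have "degree (jacobi_poly a b n) = n"
      unfolding Suc jacobi_poly.simps using less_imp_neq[OF a[of k]] by (subst degree_smult_eq) auto
    then show ?thesis using Suc by (auto simp del: jacobi_poly.simps)
  qed simp
qed

text \<open>The recurrence makes the sum telescope.\<close>
lemma christoffel_darboux:
  assumes a: "\<And>n. a n > 0"
  shows "of_real (a n) * (poly (jacobi_poly a b (Suc n)) z * poly (jacobi_poly a b n) w -
            poly (jacobi_poly a b n) z * poly (jacobi_poly a b (Suc n)) w) =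
         (z - w) * (\<Sum>j\<le>n. poly (jacobi_poly a b j) z * poly (jacobi_poly a b j) w)"
proof (induction n)
  case (Suc n)
  let ?q = "jacobi_poly a b"
  have a0: "a k \<noteq> 0" for k using a[of k] by simp
  note rec = poly_jacobi_poly_rec[of a, OF a0, where b = b and n = "Suc n"]
  have "of_real (a (Suc n)) * (poly (?q (Suc (Suc n))) z * poly (?q (Suc n)) w -
            poly (?q (Suc n)) z * poly (?q (Suc (Suc n))) w) =
        (of_real (a (Suc n)) * poly (?q (Suc (Suc n))) z) * poly (?q (Suc n)) w -
            poly (?q (Suc n)) z * (of_real (a (Suc n)) * poly (?q (Suc (Suc n))) w)"
    by (simp add: algebra_simps del: jacobi_poly.simps)
  also have "\<dots> = (z - w) * (poly (?q (Suc n)) z * poly (?q (Suc n)) w) +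
      of_real (a n) * (poly (?q (Suc n)) z * poly (?q n) w - poly (?q n) z * poly (?q (Suc n)) w)"
    unfolding rec by (simp add: algebra_simps del: jacobi_poly.simps)
  also have "\<dots> = (z - w) * (\<Sum>j\<le>Suc n. poly (?q j) z * poly (?q j) w)"
    unfolding Suc.IH by (simp add: algebra_simps del: jacobi_poly.simps)
  finally show ?case .
next
  case 0
  have a0: "a k \<noteq> 0" for k using a[of k] by simp
  show ?case using a0[of 0] by (simp add: field_simps)
qed

text \<open>The limit \<open>w \<rightarrow> z\<close> of the Christoffel-Darboux identity, proved by the same induction.\<close>
lemma christoffel_darboux_confluent:
  assumes a: "\<And>n. a n > 0"
  shows "of_real (a n) * (poly (pderiv (jacobi_poly a b (Suc n))) z * poly (jacobi_poly a b n) z -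
            poly (pderiv (jacobi_poly a b n)) z * poly (jacobi_poly a b (Suc n)) z) =
         (\<Sum>j\<le>n. poly (jacobi_poly a b j) z * poly (jacobi_poly a b j) z)"
proof (induction n)
  case (Suc n)
  let ?q = "jacobi_poly a b"
  have a0: "a k \<noteq> 0" for k using a[of k] by simp
  note rec = poly_jacobi_poly_rec[of a, OF a0, where b = b and n = "Suc n"]
    poly_pderiv_jacobi_poly_rec[of a, OF a0, where b = b and n = "Suc n"]
  have "of_real (a (Suc n)) * (poly (pderiv (?q (Suc (Suc n)))) z * poly (?q (Suc n)) z -
            poly (pderiv (?q (Suc n))) z * poly (?q (Suc (Suc n))) z) =
        (of_real (a (Suc n)) * poly (pderiv (?q (Suc (Suc n)))) z) * poly (?q (Suc n)) z -
            poly (pderiv (?q (Suc n))) z * (of_real (a (Suc n)) * poly (?q (Suc (Suc n))) z)"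
    by (simp add: algebra_simps del: jacobi_poly.simps)
  also have "\<dots> = poly (?q (Suc n)) z * poly (?q (Suc n)) z +
      of_real (a n) * (poly (pderiv (?q (Suc n))) z * poly (?q n) z - poly (pderiv (?q n)) z * poly (?q (Suc n)) z)"
    unfolding rec by (simp add: algebra_simps del: jacobi_poly.simps)
  also have "\<dots> = (\<Sum>j\<le>Suc n. poly (?q j) z * poly (?q j) z)"
    unfolding Suc.IH by (simp add: algebra_simps del: jacobi_poly.simps)
  finally show ?case .
next
  case 0
  have a0: "a k \<noteq> 0" for k using a[of k] by simp
  show ?case using a0[of 0] by (simp add: pderiv_smult pderiv_pCons)
qed

lemma sum_jacobi_poly_cnj_nonzero:
  "(\<Sum>j\<le>n. poly (jacobi_poly a b j) z * poly (jacobi_poly a b j) (cnj z)) \<noteq> 0"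
proof -
  have "(\<Sum>j\<le>n. poly (jacobi_poly a b j) z * poly (jacobi_poly a b j) (cnj z)) =
      of_real (\<Sum>j\<le>n. (norm (poly (jacobi_poly a b j) z))\<^sup>2)"
    by (simp only: of_real_sum complex_norm_square cnj_poly_jacobi_poly)
  moreover have "(\<Sum>j\<le>n. (norm (poly (jacobi_poly a b j) z))\<^sup>2) \<ge> (norm (poly (jacobi_poly a b 0) z))\<^sup>2"
    by (rule member_le_sum) auto
  ultimately show ?thesis by (smt (verit) jacobi_poly.simps(1) norm_one of_real_eq_0_iff one_power2 poly_1)
qed

text \<open>At a root \<open>z\<close> the Christoffel-Darboux identity with \<open>w = cnj z\<close> has left-hand side zero, while the sum on the right is a
  sum of squared absolute values containing \<open>\<bar>q\<^sub>0\<bar>\<^sup>2 = 1\<close>.\<close>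
lemma jacobi_poly_root_real:
  assumes a: "\<And>n. a n > 0" and root: "poly (jacobi_poly a b (Suc n)) z = 0"
  shows "cnj z = z"
  using christoffel_darboux[where a = a and b = b and n = n and z = z and w = "cnj z", OF a] sum_jacobi_poly_cnj_nonzero[of a b z n] root
  by (simp add: cnj_poly_jacobi_poly del: jacobi_poly.simps)

text \<open>At a double root the confluent identity would make a sum of squares of real numbers vanish that contains
  \<open>q\<^sub>0\<^sup>2 = 1\<close>. So all roots are simple.\<close>
lemma card_roots_jacobi_poly:
  assumes a: "\<And>n. a n > 0"
  shows "card {z. poly (jacobi_poly a b (Suc n)) z = 0} = Suc n"
proof -
  let ?q = "jacobi_poly a b (Suc n)"
  have q: "?q \<noteq> 0" "degree ?q = Suc n"
    using degree_jacobi_poly[where a = a and b = b and n = "Suc n", OF a] by auto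
  have "\<not> (poly (jacobi_poly a b (Suc n)) z = 0 \<and> poly (pderiv (jacobi_poly a b (Suc n))) z = 0)" for z
    using christoffel_darboux_confluent[where a = a and b = b and n = n and z = z, OF a] sum_jacobi_poly_cnj_nonzero[of a b z n]
      jacobi_poly_root_real[where a = a and b = b and n = n and z = z, OF a] by (auto simp del: jacobi_poly.simps)
  then have "rsquarefree (jacobi_poly a b (Suc n))" by (simp add: rsquarefree_roots del: jacobi_poly.simps)
  then have "Polynomial.smult (lead_coeff ?q) (\<Prod>z | poly ?q z = 0. [:- z, 1:]) = ?q"
    by (rule complex_poly_decompose_rsquarefree)
  then have "degree ?q = degree (\<Prod>z | poly ?q z = 0. [:- z, 1:])"
    by (metis degree_smult_eq leading_coeff_0_iff q(1))
  also have "\<dots> = card {z. poly ?q z = 0}"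
    by (subst degree_prod_sum_eq) auto
  finally show ?thesis using q(2) by simp
qed

lemma sum_tridiagonal:
  fixes f :: "nat \<Rightarrow> real"
  assumes "i < N" and z: "\<And>j. j < N \<Longrightarrow> i + 1 < j \<or> j + 1 < i \<Longrightarrow> f j = 0"
  shows "(\<Sum>j<N. f j) = (if i = 0 then 0 else f (i - 1)) + f i + (if i + 1 < N then f (i + 1) else 0)"
proof -
  have "(\<Sum>j<N. f j) = sum f ({i - 1, i, i + 1} \<inter> {..<N})"
    using assms by (intro sum.mono_neutral_right) fastforce+
  also have "{i - 1, i, i + 1} \<inter> {..<N} = (if i = 0 then {} else {i - 1}) \<union> {i} \<union> (if i + 1 < N then {i + 1} else {})"
    using assms(1) by auto
  also have "sum f \<dots> = (if i = 0 then 0 else f (i - 1)) + f i + (if i + 1 < N then f (i + 1) else 0)"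
    using assms(1) by auto
  finally show ?thesis .
qed

text \<open>At a root of the last polynomial the recurrence becomes the eigenvalue equation, and the
  Christoffel-Darboux identity at two different roots is the orthogonality of the eigenvectors.\<close>
theorem jacobi_matrix_spectral_data:
  assumes jac: "jacobi_matrix N A" and N: "N \<ge> 1"
  shows "\<exists>l m p. inj_on l {..<N} \<and> (\<forall>k<N. m k > 0) \<and> spectral_data N A l m p"
proof -
  \<comment> \<open>The entry past the corner is arbitrary: it only scales the last polynomial.\<close>
  define a where "a i = (if i + 1 < N then A $$ (i, i + 1) else 1)" for i
  define b where "b i = A $$ (i, i)" for i
  have a: "a n > 0" for n using jac by (auto simp: a_def jacobi_matrix_def)
  have a0: "a n \<noteq> 0" for n using a[of n] by simp
  let ?q = "jacobi_poly a b"
  obtain n where n: "N = Suc n" using N by (cases N) auto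
  define Z where "Z = {z. poly (?q N) z = 0}"
  have Z: "card Z = N" unfolding Z_def n by (rule card_roots_jacobi_poly[OF a])
  then have "finite Z" using N by (metis card.infinite not_one_le_zero)
  then obtain e where e: "bij_betw e {..<N} Z"
    using ex_bij_betw_nat_finite Z by (metis atLeast0LessThan)
  define l where "l k = Re (e k)" for k
  have el: "e k = of_real (l k)" and root: "poly (?q N) (e k) = 0" if "k < N" for k
  proof -
    have "e k \<in> Z" using e that by (auto simp: bij_betw_def)
    then show "poly (?q N) (e k) = 0" by (simp add: Z_def)
    then have "cnj (e k) = e k" unfolding n by (rule jacobi_poly_root_real[OF a])
    then show "e k = of_real (l k)" by (simp add: l_def complex_eq_iff)
  qed
  define p where "p i k = Re (poly (?q i) (e k))" for i k
  have pe: "poly (?q i) (e k) = of_real (p i k)" if "k < N" for i k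
  proof -
    have "cnj (e k) = e k" by (simp add: el[OF that])
    then have "cnj (poly (?q i) (e k)) = poly (?q i) (e k)"
      using cnj_poly_jacobi_poly[of a b i "e k"] by metis
    then show ?thesis by (simp add: p_def complex_eq_iff)
  qed
  have inj: "inj_on l {..<N}"
    using e el unfolding bij_betw_def inj_on_def by (metis lessThan_iff)
  have rec: "a i * p (Suc i) k = (l k - b i) * p i k - (if i = 0 then 0 else a (i - 1) * p (i - 1) k)" if "k < N" for i k
  proof -
    have "complex_of_real (a i * p (Suc i) k) = of_real ((l k - b i) * p i k - (if i = 0 then 0 else a (i - 1) * p (i - 1) k))"
      using poly_jacobi_poly_rec[of a i b "e k", OF a0] pe[OF that] el[OF that] by (simp del: jacobi_poly.simps)
    then show ?thesis using of_real_eq_iff by blast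
  qed
  have p0: "p 0 k = 1" for k by (simp add: p_def)
  have pN: "p N k = 0" if "k < N" for k using root[OF that] by (simp add: p_def)
  have eigen: "(\<Sum>j<N. A $$ (i, j) * p j k) = l k * p i k" if i: "i < N" and k: "k < N" for i k
  proof -
    have "(\<Sum>j<N. A $$ (i, j) * p j k) = (if i = 0 then 0 else A $$ (i, i - 1) * p (i - 1) k) + A $$ (i, i) * p i k +
        (if i + 1 < N then A $$ (i, i + 1) * p (i + 1) k else 0)"
      using jac i by (intro sum_tridiagonal[OF i]) (auto simp: jacobi_matrix_def)
    also have "(if i + 1 < N then A $$ (i, i + 1) * p (i + 1) k else 0) = a i * p (Suc i) k"
      using i pN[OF k] by (cases "i + 1 < N") (auto simp: a_def not_less le_Suc_eq less_Suc_eq_le dest!: Suc_leI le_antisym)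
    also have "(if i = 0 then 0 else A $$ (i, i - 1) * p (i - 1) k) = (if i = 0 then 0 else a (i - 1) * p (i - 1) k)"
      using i jac by (auto simp: a_def jacobi_matrix_def)
    finally show ?thesis unfolding rec[OF k] by (simp add: b_def algebra_simps)
  qed
  have orth: "(\<Sum>j<N. p j k * p j k') = 0" if k: "k < N" "k' < N" "k \<noteq> k'" for k k'
  proof -
    have "(e k - e k') * of_real (\<Sum>j\<le>n. p j k * p j k') = 0"
      using christoffel_darboux[where a = a and b = b and n = n and z = "e k" and w = "e k'", OF a] root[OF k(1)] root[OF k(2)]
      unfolding n[symmetric] by (simp add: pe k)
    moreover have "e k - e k' \<noteq> 0" using inj k by (auto simp: inj_on_def el)
    ultimately have "complex_of_real (\<Sum>j\<le>n. p j k * p j k') = 0"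
      using mult_eq_0_iff by blast
    then show ?thesis unfolding n lessThan_Suc_atMost of_real_eq_0_iff .
  qed
  \<comment> \<open>The inverse squared length of the eigenvector, so that \<open>sqrt (m k) * p j k\<close> is an orthogonal matrix.\<close>
  define m where "m k = 1 / (\<Sum>j<N. p j k * p j k)" for k
  have pos: "(\<Sum>j<N. p j k * p j k) > 0" for k
  proof -
    have "p 0 k * p 0 k \<le> (\<Sum>j<N. p j k * p j k)" using N by (intro member_le_sum) auto
    then show ?thesis by (simp add: p0)
  qed
  then have m: "m k > 0" for k by (simp add: m_def)
  have rows: "(\<Sum>j<N. (sqrt (m k) * p j k) * (sqrt (m k') * p j k')) = (if k = k' then 1 else 0)"
    if "k < N" "k' < N" for k k'
  proof -
    have "(\<Sum>j<N. (sqrt (m k) * p j k) * (sqrt (m k') * p j k')) = sqrt (m k) * sqrt (m k') * (\<Sum>j<N. p j k * p j k')"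
      by (simp add: sum_distrib_left mult_ac)
    then show ?thesis using orth[OF that] pos[of k] m[of k] by (auto simp: m_def)
  qed
  have "(\<Sum>k<N. m k * p i k) = (if i = 0 then 1 else 0)" if i: "i < N" for i
  proof -
    have "(\<Sum>k<N. (sqrt (m k) * p i k) * (sqrt (m k) * p 0 k)) = (if i = 0 then 1 else 0)"
      using N i by (intro orthonormal_rows_imp_columns[of N "\<lambda>k j. sqrt (m k) * p j k"] rows) auto
    moreover have "(sqrt (m k) * p i k) * (sqrt (m k) * p 0 k) = m k * p i k" for k
      using m[of k] by (simp add: p0 mult_ac)
    ultimately show ?thesis by simp
  qed
  then have "spectral_data N A l m p" using eigen p0 by (simp add: spectral_data_def)
  then show ?thesis using inj m by (intro exI conjI) auto
qed

section \<open>The Jacobi matrix with given spectral data\<close>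

definition weighted_inner :: "nat \<Rightarrow> (nat \<Rightarrow> real) \<Rightarrow> (nat \<Rightarrow> real) \<Rightarrow> real poly \<Rightarrow> real poly \<Rightarrow> real" where
  "weighted_inner N l m p q = (\<Sum>k<N. m k * (poly p (l k) * poly q (l k)))"

lemma weighted_inner_diff_right: "weighted_inner N l m p (q - q') = weighted_inner N l m p q - weighted_inner N l m p q'"
  by (simp add: weighted_inner_def right_diff_distrib sum_subtractf)

lemma weighted_inner_smult_right: "weighted_inner N l m p (Polynomial.smult c q) = c * weighted_inner N l m p q"
  by (simp add: weighted_inner_def sum_distrib_left mult_ac)

lemma weighted_inner_sum_right: "weighted_inner N l m p (\<Sum>j\<in>J. q j) = (\<Sum>j\<in>J. weighted_inner N l m p (q j))"
  unfolding weighted_inner_def poly_sum sum_distrib_left by (rule sum.swap)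

lemma weighted_inner_commute: "weighted_inner N l m p q = weighted_inner N l m q p"
  by (simp add: weighted_inner_def mult_ac)

text \<open>A polynomial of degree below \<open>N\<close> cannot vanish at \<open>N\<close> points, so the form is definite in these degrees.\<close>
lemma weighted_inner_self_pos:
  assumes "inj_on l {..<N}" "\<And>k. k < N \<Longrightarrow> m k > 0" "p \<noteq> 0" "degree p < N"
  shows "weighted_inner N l m p p > 0"
proof (rule ccontr)
  assume neg: "\<not> ?thesis"
  have nn: "m k * (poly p (l k) * poly p (l k)) \<ge> 0" if "k \<in> {..<N}" for k
    using assms(2)[of k] that by simp
  have "weighted_inner N l m p p \<ge> 0"
    unfolding weighted_inner_def by (rule sum_nonneg) (rule nn)
  then have "(\<Sum>k<N. m k * (poly p (l k) * poly p (l k))) = 0"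
    using neg unfolding weighted_inner_def by linarith
  then have "\<forall>k\<in>{..<N}. m k * (poly p (l k) * poly p (l k)) = 0"
    using sum_nonneg_eq_0_iff[of "{..<N}" "\<lambda>k. m k * (poly p (l k) * poly p (l k))"] nn by simp
  then have "poly p (l k) = 0" if "k < N" for k
    using assms(2)[OF that] that by force
  then have "l ` {..<N} \<subseteq> {x. poly p x = 0}" by auto
  then have "card (l ` {..<N}) \<le> card {x. poly p x = 0}"
    using poly_roots_finite[OF assms(3)] by (intro card_mono)
  also have "\<dots> \<le> degree p" by (rule card_poly_roots_bound[OF assms(3)])
  finally show False using card_image[OF assms(1)] assms(4) by simp
qed

text \<open>Subtracting a multiple of the member of equal degree lowers the degree of \<open>q\<close>; thus a family with one polynomial of
  each degree below \<open>n\<close> spans.\<close>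
lemma orthogonal_to_lower_degree:
  assumes deg: "\<And>j. j < n \<Longrightarrow> degree (p j) = j \<and> p j \<noteq> 0"
    and orth: "\<And>j. j < n \<Longrightarrow> weighted_inner N l m P (p j) = 0"
  shows "degree q < n \<Longrightarrow> weighted_inner N l m P q = 0"
proof (induction "degree q" arbitrary: q rule: less_induct)
  case less
  define d where "d = degree q"
  have d: "d < n" "degree (p d) = d" "p d \<noteq> 0" using less.prems deg by (auto simp: d_def)
  define r where "r = q - Polynomial.smult (lead_coeff q / lead_coeff (p d)) (p d)"
  have "degree r \<le> d" unfolding r_def
    using degree_smult_le[of _ "p d"] d(2) by (intro degree_diff_le) (auto simp: d_def)
  moreover have "coeff (p d) d \<noteq> 0" using d(2,3) leading_coeff_0_iff[of "p d"] by simp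
  then have "coeff r d = 0" using d(2) by (simp add: r_def d_def[symmetric])
  ultimately have "r = 0 \<or> degree r < d" using eq_zero_or_degree_less by blast
  then have "weighted_inner N l m P r = 0"
  proof
    assume "degree r < d"
    then show ?thesis using less.hyps[of r] d(1) unfolding d_def by simp
  qed (simp add: weighted_inner_def)
  then show ?case
    using orth[OF d(1)] by (simp add: r_def weighted_inner_diff_right weighted_inner_smult_right)
qed

text \<open>Gram-Schmidt applied to the monomials.\<close>
lemma orthonormal_polynomials:
  assumes inj: "inj_on l {..<N}" and m: "\<And>k. k < N \<Longrightarrow> m k > 0"
  shows "\<exists>p. \<forall>n\<in>{..<N}. degree (p n) = n \<and> lead_coeff (p n) > 0 \<and> weighted_inner N l m (p n) (p n) = 1 \<and>
    (\<forall>q. degree q < n \<longrightarrow> weighted_inner N l m (p n) q = 0)"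
proof -
  let ?ip = "weighted_inner N l m"
  let ?G = "\<lambda>n p. degree p = n \<and> lead_coeff p > 0 \<and> ?ip p p = 1 \<and> (\<forall>q. degree q < n \<longrightarrow> ?ip p q = 0)"
  have "n < N \<longrightarrow> (\<exists>p. ?G n p)" for n
  proof (induction n rule: less_induct)
    case (less n)
    show ?case
    proof
      assume n: "n < N"
      then have "\<forall>j\<in>{..<n}. \<exists>p. ?G j p" using less by auto
      then obtain p where p: "\<forall>j\<in>{..<n}. ?G j (p j)" by (rule bchoice[THEN exE])
      have pd: "degree (p j) = j \<and> p j \<noteq> 0" if "j < n" for j
        using bspec[OF p, of j] that by auto
      have ortho: "?ip (p i) (p j) = (if i = j then 1 else 0)" if ij: "i < n" "j < n" for i j
      proof (cases i j rule: linorder_cases)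
        case less
        then have "?ip (p j) (p i) = 0" using p pd ij by auto
        then show ?thesis using less by (simp add: weighted_inner_commute)
      qed (use p pd ij in auto)
      define P where "P = monom 1 n - (\<Sum>j<n. Polynomial.smult (?ip (monom 1 n) (p j)) (p j))"
      have low: "n > 0 \<Longrightarrow> degree (\<Sum>j<n. Polynomial.smult (?ip (monom 1 n) (p j)) (p j)) < n"
        using pd by (intro degree_sum_less) (auto intro: le_less_trans[OF degree_smult_le])
      have P: "degree P = n" "lead_coeff P = 1"
      proof -
        have c: "coeff (\<Sum>j<n. Polynomial.smult (?ip (monom 1 n) (p j)) (p j)) n = 0"
          using low by (cases "n = 0") (auto intro: coeff_eq_0)
        have "degree P \<le> n" unfolding P_def
          using low by (intro degree_diff_le degree_monom_le) (cases "n = 0"; auto)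
        moreover have Pn: "coeff P n = 1" by (simp add: P_def c)
        ultimately show "degree P = n" using le_degree[of P n] by simp
        then show "lead_coeff P = 1" using Pn by simp
      qed
      have "?ip P (p i) = 0" if i: "i < n" for i
      proof -
        have "?ip (p i) P = ?ip (p i) (monom 1 n) - (\<Sum>j<n. ?ip (monom 1 n) (p j) * ?ip (p i) (p j))"
          by (simp add: P_def weighted_inner_diff_right weighted_inner_sum_right weighted_inner_smult_right)
        also have "(\<Sum>j<n. ?ip (monom 1 n) (p j) * ?ip (p i) (p j)) = (\<Sum>j<n. if j = i then ?ip (monom 1 n) (p j) else 0)"
          using ortho[OF i] by (intro sum.cong) auto
        finally show ?thesis using i by (simp add: weighted_inner_commute)
      qed
      then have orthP: "degree q < n \<Longrightarrow> ?ip P q = 0" for q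
        using orthogonal_to_lower_degree[of n p N l m P q] pd by blast
      have "P \<noteq> 0" using P by auto
      then have pos: "?ip P P > 0" using weighted_inner_self_pos[where m = m, OF inj m] P(1) n by simp
      define c where "c = 1 / sqrt (?ip P P)"
      have c: "c > 0" "c * c * ?ip P P = 1" using pos by (auto simp: c_def)
      have "?G n (Polynomial.smult c P)"
      proof (intro conjI allI impI)
        show "degree (Polynomial.smult c P) = n" using c P by simp
        show "lead_coeff (Polynomial.smult c P) > 0" using c P by simp
        have "?ip (Polynomial.smult c P) q = c * ?ip P q" for q
          by (metis weighted_inner_commute weighted_inner_smult_right)
        then show "?ip (Polynomial.smult c P) (Polynomial.smult c P) = 1"
          and "\<And>q. degree q < n \<Longrightarrow> ?ip (Polynomial.smult c P) q = 0"
          using c orthP by (simp_all add: weighted_inner_smult_right)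
      qed
      then show "\<exists>p. ?G n p" by blast
    qed
  qed
  then have "\<forall>n\<in>{..<N}. \<exists>p. ?G n p" by simp
  then show ?thesis by (rule bchoice)
qed

text \<open>The matrix is multiplication by the variable, expressed in the basis of orthonormal
  polynomials. It is tridiagonal since this operator raises the degree by one and is symmetric; the off-diagonal entries are
  quotients of consecutive leading coefficients, hence positive.\<close>
theorem spectral_data_exists_jacobi_matrix:
  assumes inj: "inj_on l {..<N}" and m: "\<And>k. k < N \<Longrightarrow> m k > 0" and sum1: "(\<Sum>k<N. m k) = 1"
    and N: "N \<ge> 1"
  shows "\<exists>A p. jacobi_matrix N A \<and> spectral_data N A l m p"
proof -
  let ?ip = "weighted_inner N l m"
  obtain p where p': "\<forall>n\<in>{..<N}. degree (p n) = n \<and> lead_coeff (p n) > 0 \<and> ?ip (p n) (p n) = 1 \<and>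
    (\<forall>q. degree q < n \<longrightarrow> ?ip (p n) q = 0)"
    using orthonormal_polynomials[where m = m, OF inj m] by (rule exE)
  have p: "degree (p n) = n \<and> lead_coeff (p n) > 0 \<and> ?ip (p n) (p n) = 1 \<and>
    (\<forall>q. degree q < n \<longrightarrow> ?ip (p n) q = 0)" if "n < N" for n
    using bspec[OF p', of n] that by blast
  have cp: "coeff (p n) n > 0" if "n < N" for n
    using p[OF that] by (elim conjE) simp
  have ortho: "?ip (p i) (p j) = (if i = j then 1 else 0)" if ij: "i < N" "j < N" for i j
  proof (cases i j rule: linorder_cases)
    case less
    then have "?ip (p j) (p i) = 0" using p ij by auto
    then show ?thesis using less by (simp add: weighted_inner_commute)
  qed (use p ij in auto)
  have sqrtm: "sqrt (m k) * sqrt (m k) = m k" "sqrt (m k) > 0" if "k < N" for k using m[OF that] by simp_all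
  \<comment> \<open>The matrix \<open>sqrt (m k) * p j (l k)\<close> is orthogonal; its other orthogonality relation inverts the expansion in the \<open>p j\<close>.\<close>
  have cols: "(\<Sum>j<N. (sqrt (m k) * poly (p j) (l k)) * (sqrt (m k') * poly (p j) (l k'))) = (if k = k' then 1 else 0)"
    if "k < N" "k' < N" for k k'
  proof (rule orthonormal_rows_imp_columns[of N "\<lambda>j k. sqrt (m k) * poly (p j) (l k)", OF _ that])
    fix i j assume ij: "i < N" "j < N"
    have "(\<Sum>k<N. (sqrt (m k) * poly (p i) (l k)) * (sqrt (m k) * poly (p j) (l k))) = ?ip (p i) (p j)"
      unfolding weighted_inner_def
    proof (intro sum.cong refl)
      fix k assume "k \<in> {..<N}"
      then have "sqrt (m k) * sqrt (m k) = m k" using sqrtm(1) by simp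
      then show "(sqrt (m k) * poly (p i) (l k)) * (sqrt (m k) * poly (p j) (l k)) = m k * (poly (p i) (l k) * poly (p j) (l k))"
        by (metis mult.assoc mult.left_commute)
    qed
    then show "(\<Sum>k<N. (sqrt (m k) * poly (p i) (l k)) * (sqrt (m k) * poly (p j) (l k))) = (if i = j then 1 else 0)"
      using ortho[OF ij] by simp
  qed
  define A where "A = mat N N (\<lambda>(i, j). ?ip (p j) ([:0, 1:] * p i))"
  have A: "A $$ (i, j) = (\<Sum>k<N. m k * l k * poly (p i) (l k) * poly (p j) (l k))" if "i < N" "j < N" for i j
    using that by (simp add: A_def weighted_inner_def mult_ac)
  have jac: "jacobi_matrix N A"
    unfolding jacobi_matrix_def
  proof (intro conjI allI impI)
    show "A \<in> carrier_mat N N" by (simp add: A_def)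
    show "A $$ (i, j) = A $$ (j, i)" if "i < N" "j < N" for i j
      using that by (simp add: A mult_ac)
    have degx: "degree ([:0, 1:] * p i) = i + 1" if "i < N" for i
    proof -
      have "p i \<noteq> 0" using p[OF that] by auto
      then show ?thesis using p[OF that] by (subst degree_mult_eq) auto
    qed
    show "A $$ (i, j) = 0" if "i < N" "j < N" "i + 1 < j" for i j
      using p[OF that(2)] degx[OF that(1)] that by (simp add: A_def del: mult_pCons_left)
    show "A $$ (i, i + 1) > 0" if i: "i + 1 < N" for i
    proof -
      have i': "i < N" using i by simp
      define c where "c = coeff (p i) i / coeff (p (i + 1)) (i + 1)"
      have c: "c > 0" using cp[OF i] cp[OF i'] by (simp add: c_def)
      \<comment> \<open>The difference cancels the leading terms, hence is orthogonal to \<open>p (i + 1)\<close>.\<close>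
      define q where "q = [:0, 1:] * p i - Polynomial.smult c (p (i + 1))"
      have "degree q \<le> i + 1" unfolding q_def
        using degx[OF i'] p[OF i] by (intro degree_diff_le) auto
      moreover have "coeff q (i + 1) = 0"
        using cp[OF i] by (simp add: q_def c_def)
      ultimately have "degree q < i + 1" using eq_zero_or_degree_less[of q "i + 1"] by auto
      then have "?ip (p (i + 1)) q = 0" using p[OF i] by blast
      then have "?ip (p (i + 1)) ([:0, 1:] * p i) = c"
        using p[OF i] by (simp add: q_def weighted_inner_diff_right weighted_inner_smult_right del: mult_pCons_left)
      then show ?thesis using c i by (simp add: A_def del: mult_pCons_left)
    qed
  qed
  have eigen: "(\<Sum>j<N. A $$ (i, j) * poly (p j) (l k)) = l k * poly (p i) (l k)" if i: "i < N" and k: "k < N" for i k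
  proof -
    have "(\<Sum>j<N. A $$ (i, j) * poly (p j) (l k)) =
        (\<Sum>j<N. \<Sum>k'<N. m k' * l k' * poly (p i) (l k') * (poly (p j) (l k') * poly (p j) (l k)))"
      using i by (simp add: A sum_distrib_right sum_distrib_left mult_ac)
    also have "\<dots> = (\<Sum>k'<N. \<Sum>j<N. m k' * l k' * poly (p i) (l k') * (poly (p j) (l k') * poly (p j) (l k)))"
      by (rule sum.swap)
    also have "\<dots> = (\<Sum>k'<N. if k' = k then l k * poly (p i) (l k) else 0)"
    proof (intro sum.cong refl)
      fix k' assume "k' \<in> {..<N}"
      then have k': "k' < N" by simp
      have "sqrt (m k') * sqrt (m k) * (\<Sum>j<N. poly (p j) (l k') * poly (p j) (l k)) = (if k' = k then 1 else 0)"
        using cols[OF k' k] by (simp add: sum_distrib_left mult_ac)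
      then have *: "k' \<noteq> k \<Longrightarrow> (\<Sum>j<N. poly (p j) (l k') * poly (p j) (l k)) = 0"
        and **: "k' = k \<Longrightarrow> m k * (\<Sum>j<N. poly (p j) (l k) * poly (p j) (l k)) = 1"
        using sqrtm(1)[OF k] m[OF k] m[OF k'] by simp_all
      have "(\<Sum>j<N. m k' * l k' * poly (p i) (l k') * (poly (p j) (l k') * poly (p j) (l k))) =
          l k' * poly (p i) (l k') * (m k' * (\<Sum>j<N. poly (p j) (l k') * poly (p j) (l k)))"
        by (simp add: sum_distrib_left mult_ac)
      then show "(\<Sum>j<N. m k' * l k' * poly (p i) (l k') * (poly (p j) (l k') * poly (p j) (l k))) =
          (if k' = k then l k * poly (p i) (l k) else 0)"
        using * ** by (cases "k' = k") auto
    qed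
    also have "\<dots> = l k * poly (p i) (l k)" using k by simp
    finally show ?thesis .
  qed
  have p0: "poly (p 0) x = 1" for x
  proof -
    have "degree (p 0) = 0" using p[of 0] N by simp
    then obtain c where c: "p 0 = [:c:]" by (rule degree_eq_zeroE)
    have c0: "c > 0" using p[of 0] N c by simp
    have cc: "c * c = 1"
    proof -
      have "?ip (p 0) (p 0) = (\<Sum>k<N. m k) * (c * c)" by (simp add: weighted_inner_def c sum_distrib_right)
      then show ?thesis using p[of 0] N sum1 by simp
    qed
    have "(c - 1) * (c + 1) = 0" using cc by (simp add: algebra_simps)
    then have "c - 1 = 0 \<or> c + 1 = 0" by (simp only: mult_eq_0_iff)
    then have "c = 1" using c0 by linarith
    then show ?thesis unfolding c by simp
  qed
  have unit: "(\<Sum>k<N. m k * poly (p i) (l k)) = (if i = 0 then 1 else 0)" if "i < N" for i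
  proof -
    have "?ip (p i) (p 0) = (\<Sum>k<N. m k * poly (p i) (l k))"
      unfolding weighted_inner_def p0 mult_1_right ..
    moreover have "?ip (p i) (p 0) = (if i = 0 then 1 else 0)" using that N by (intro ortho) auto
    ultimately show ?thesis by (rule subst)
  qed
  have sp: "spectral_data N A l m (\<lambda>i k. poly (p i) (l k))"
    unfolding spectral_data_def by (intro conjI allI impI eigen p0 unit)
  show ?thesis using jac sp by (intro exI conjI)
qed

section \<open>Integral operators with a separated kernel\<close>

text \<open>A null vector of the Gram matrix gives a continuous combination of the \<open>e k\<close> with norm zero, that is,
  a linear relation on the interval.\<close>
lemma gram_matrix_inverse:
  fixes e :: "nat \<Rightarrow> real \<Rightarrow> real"
  assumes T: "T > 0" and cont: "\<And>k. k < N \<Longrightarrow> continuous_on {0..T} (e k)"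
    and indep: "\<And>c i. (\<And>x. x \<in> {0<..<T} \<Longrightarrow> (\<Sum>k<N. c k * e k x) = 0) \<Longrightarrow> i < N \<Longrightarrow> c i = 0"
  shows "\<exists>g. \<forall>i<N. \<forall>j<N. (\<Sum>k<N. L2_inner T (e i) (e k) * g k j) = (if i = j then 1 else 0) \<and>
    (\<Sum>k<N. g i k * L2_inner T (e k) (e j)) = (if i = j then 1 else 0)"
proof -
  define G where "G = mat N N (\<lambda>(i, j). L2_inner T (e i) (e j))"
  have G: "G \<in> carrier_mat N N" by (simp add: G_def)
  have "det G \<noteq> 0"
  proof
    assume "det G = 0"
    then obtain v where v: "v \<in> carrier_vec N" "v \<noteq> 0\<^sub>v N" "G *\<^sub>v v = 0\<^sub>v N"
      using det_0_iff_vec_prod_zero_field[OF G] by blast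
    define h where "h x = (\<Sum>k<N. v $ k * e k x)" for x
    have conth: "continuous_on {0..T} h"
      unfolding h_def using cont by (intro continuous_intros) auto
    have eh: "L2_inner T (e i) h = 0" if i: "i < N" for i
    proof -
      have "L2_inner T (e i) h = (\<Sum>k<N. v $ k * L2_inner T (e i) (e k))"
        unfolding h_def using cont i by (intro L2_inner_sum L2_continuous) auto
      also have "\<dots> = (G *\<^sub>v v) $ i"
        using i v(1) by (simp add: G_def scalar_prod_def atLeast0LessThan mult.commute)
      finally show ?thesis using i v(3) by simp
    qed
    have "L2_inner T h (\<lambda>x. \<Sum>k<N. v $ k * e k x) = (\<Sum>k<N. v $ k * L2_inner T h (e k))"
      using cont by (intro L2_inner_sum L2_continuous conth) auto
    moreover have "(\<lambda>x. \<Sum>k<N. v $ k * e k x) = h" by (simp add: h_def fun_eq_iff)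
    ultimately have "L2_inner T h h = (\<Sum>k<N. v $ k * L2_inner T h (e k))" by simp
    also have "\<dots> = 0"
      using eh by (intro sum.neutral) (auto simp: L2_inner_def mult.commute)
    finally have "integral {0..T} (\<lambda>x. h x * h x) = 0"
      using L2_inner_closed_interval[OF conth L2_continuous[OF conth]]
      by (simp add: lebesgue_integral_eq_integral)
    then have "\<forall>x\<in>{0..T}. h x * h x = 0"
      using T conth by (subst (asm) integral_eq_0_iff) (auto intro!: continuous_intros)
    then have "(\<Sum>k<N. v $ k * e k x) = 0" if "x \<in> {0<..<T}" for x
      using that by (auto simp: h_def)
    then have "v $ i = 0" if "i < N" for i using indep[of "\<lambda>k. v $ k"] that by blast
    then have "v = 0\<^sub>v N" using v(1) by (intro eq_vecI) auto
    then show False using v(2) by simp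
  qed
  then have "G \<in> Units (ring_mat TYPE(real) N ())" by (rule det_non_zero_imp_unit[OF G])
  then obtain B where B: "B \<in> carrier_mat N N" "B * G = 1\<^sub>m N" "G * B = 1\<^sub>m N"
    by (auto simp: Units_def ring_mat_def)
  show ?thesis
  proof (intro exI[of _ "\<lambda>i j. B $$ (i, j)"] allI impI conjI)
    fix i j assume ij: "i < N" "j < N"
    have "(G * B) $$ (i, j) = 1\<^sub>m N $$ (i, j)" "(B * G) $$ (i, j) = 1\<^sub>m N $$ (i, j)" using B by auto
    then show "(\<Sum>k<N. L2_inner T (e i) (e k) * B $$ (k, j)) = (if i = j then 1 else 0)"
      and "(\<Sum>k<N. B $$ (i, k) * L2_inner T (e k) (e j)) = (if i = j then 1 else 0)"
      using ij B(1) by (simp_all add: G_def scalar_prod_def atLeast0LessThan)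
  qed
qed

text \<open>\<open>K\<close> is the operator \<open>f \<mapsto> \<Sum>\<^sub>k m\<^sub>k \<langle>e\<^sub>k, f\<rangle> e\<^sub>k\<close>, and \<open>g\<close> is the inverse of the Gram
  matrix of the \<open>e k\<close>. The inverse is a parameter so that the basis dual to \<open>e\<close> is available explicitly.\<close>
locale separated_kernel =
  fixes T :: real and N :: nat and m :: "nat \<Rightarrow> real" and e :: "nat \<Rightarrow> real \<Rightarrow> real"
    and K :: "(real \<Rightarrow> real) \<Rightarrow> real \<Rightarrow> real" and g :: "nat \<Rightarrow> nat \<Rightarrow> real"
  assumes T: "T > 0" and m: "\<And>k. k < N \<Longrightarrow> m k > 0"
    and cont: "\<And>k. k < N \<Longrightarrow> continuous_on {0..T} (e k)"
    and K: "\<And>f x. f \<in> L2 T \<Longrightarrow> x \<in> {0<..<T} \<Longrightarrow> K f x = (\<Sum>k<N. m k * L2_inner T (e k) f * e k x)"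
    and gram_right: "\<And>i j. i < N \<Longrightarrow> j < N \<Longrightarrow> (\<Sum>k<N. L2_inner T (e i) (e k) * g k j) = (if i = j then 1 else 0)"
    and gram_left: "\<And>i j. i < N \<Longrightarrow> j < N \<Longrightarrow> (\<Sum>k<N. g i k * L2_inner T (e k) (e j)) = (if i = j then 1 else 0)"

begin

lemma e_L2: "k < N \<Longrightarrow> e k \<in> L2 T"
  by (intro L2_continuous cont)

lemma combination_L2: "(\<lambda>x. \<Sum>k<N. c k * e k x) \<in> L2 T"
  by (intro L2_sum L2_cmult e_L2) simp

lemma inner_combination: "i < N \<Longrightarrow> L2_inner T (e i) (\<lambda>x. \<Sum>k<N. c k * e k x) = (\<Sum>k<N. c k * L2_inner T (e i) (e k))"
  by (intro L2_inner_sum cont e_L2) auto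

lemma K_L2:
  assumes "f \<in> L2 T"
  shows "K f \<in> L2 T"
proof -
  have "K f \<in> L2 T \<longleftrightarrow> (\<lambda>x. \<Sum>k<N. m k * L2_inner T (e k) f * e k x) \<in> L2 T"
    by (rule L2_cong) (rule K[OF assms])
  then show ?thesis using combination_L2 by simp
qed

lemma K_eq: "f \<in> L2 T \<Longrightarrow> L2_eq T (K f) (\<lambda>x. \<Sum>k<N. m k * L2_inner T (e k) f * e k x)"
  using K by (intro L2_eqI) auto

lemma combination_bounded: "\<exists>M\<ge>0. \<forall>c. norm_L2 T (\<lambda>x. \<Sum>k<N. c k * e k x) \<le> M * (\<Sum>k<N. \<bar>c k\<bar>)"
proof -
  have "\<exists>B. \<forall>k\<in>{..<N}. \<forall>x\<in>{0..T}. \<bar>e k x\<bar> \<le> B k"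
  proof (rule bchoice, rule ballI)
    fix k assume "k \<in> {..<N}"
    then have "bounded (e k ` {0..T})"
      by (intro compact_imp_bounded compact_continuous_image cont compact_Icc) auto
    then show "\<exists>B. \<forall>x\<in>{0..T}. \<bar>e k x\<bar> \<le> B" unfolding bounded_iff by auto
  qed
  then obtain B where B: "\<forall>k\<in>{..<N}. \<forall>x\<in>{0..T}. \<bar>e k x\<bar> \<le> B k" by (rule exE)
  define M where "M = (\<Sum>k<N. \<bar>B k\<bar>)"
  have BM: "\<bar>e k x\<bar> \<le> M" if "k < N" "x \<in> {0<..<T}" for k x
  proof -
    have "\<bar>e k x\<bar> \<le> B k" using bspec[OF bspec[OF B, of k], of x] that by simp
    also have "\<dots> \<le> \<bar>B k\<bar>" by simp
    also have "\<dots> \<le> M" unfolding M_def using that by (intro member_le_sum) auto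
    finally show ?thesis .
  qed
  have "norm_L2 T (\<lambda>x. \<Sum>k<N. c k * e k x) \<le> sqrt T * (M * (\<Sum>k<N. \<bar>c k\<bar>))" for c
  proof (rule norm_L2_bounded[OF combination_L2 _ T])
    fix x assume x: "x \<in> {0<..<T}"
    have "\<bar>\<Sum>k<N. c k * e k x\<bar> \<le> (\<Sum>k<N. \<bar>c k * e k x\<bar>)" by (rule sum_abs)
    also have "\<dots> \<le> (\<Sum>k<N. M * \<bar>c k\<bar>)"
    proof (rule sum_mono)
      fix k assume "k \<in> {..<N}"
      then show "\<bar>c k * e k x\<bar> \<le> M * \<bar>c k\<bar>"
        using mult_right_mono[OF BM[of k x], of "\<bar>c k\<bar>"] x by (simp add: abs_mult mult.commute)
    qed
    finally show "\<bar>\<Sum>k<N. c k * e k x\<bar> \<le> M * (\<Sum>k<N. \<bar>c k\<bar>)" by (simp add: sum_distrib_left)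
  qed
  moreover have "M \<ge> 0" by (simp add: M_def sum_nonneg)
  ultimately show ?thesis
    using T by (intro exI[of _ "sqrt T * M"]) (auto simp: mult.assoc)
qed

text \<open>Pairing with the dual basis: on the span of the \<open>e k\<close> this is the coefficient of \<open>e k\<close>.\<close>
definition coord :: "nat \<Rightarrow> (real \<Rightarrow> real) \<Rightarrow> real" where
  "coord k f = (\<Sum>j<N. g k j * L2_inner T (e j) f)"

lemma coord_combination:
  assumes "i < N"
  shows "coord i (\<lambda>x. \<Sum>k<N. c k * e k x) = c i"
proof -
  have "coord i (\<lambda>x. \<Sum>k<N. c k * e k x) = (\<Sum>j<N. \<Sum>k<N. c k * (g i j * L2_inner T (e j) (e k)))"
    by (simp add: coord_def inner_combination sum_distrib_left mult_ac)
  also have "\<dots> = (\<Sum>k<N. \<Sum>j<N. c k * (g i j * L2_inner T (e j) (e k)))" by (rule sum.swap)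
  also have "\<dots> = (\<Sum>k<N. if k = i then c k else 0)"
    using assms by (intro sum.cong refl) (auto simp: sum_distrib_left[symmetric] gram_left)
  finally show ?thesis using assms by simp
qed

lemma coord_cong: "f \<in> L2 T \<Longrightarrow> f' \<in> L2 T \<Longrightarrow> L2_eq T f f' \<Longrightarrow> coord k f = coord k f'"
  unfolding coord_def by (intro sum.cong refl arg_cong2[where f = "(*)"] L2_inner_cong cont) auto

lemma coord_K: "f \<in> L2 T \<Longrightarrow> i < N \<Longrightarrow> coord i (K f) = m i * L2_inner T (e i) f"
  using coord_cong[OF K_L2 combination_L2 K_eq] by (simp add: coord_combination)

lemma coord_bounded: "\<exists>M\<ge>0. \<forall>f\<in>L2 T. \<bar>coord k f\<bar> \<le> M * norm_L2 T f"
proof -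
  have "\<exists>M. \<forall>j\<in>{..<N}. M j \<ge> 0 \<and> (\<forall>f\<in>L2 T. \<bar>L2_inner T (e j) f\<bar> \<le> M j * norm_L2 T f)"
    by (intro bchoice ballI L2_inner_bounded cont) simp
  then obtain M where M: "\<forall>j\<in>{..<N}. M j \<ge> 0 \<and> (\<forall>f\<in>L2 T. \<bar>L2_inner T (e j) f\<bar> \<le> M j * norm_L2 T f)"
    by (rule exE)
  have "\<bar>coord k f\<bar> \<le> (\<Sum>j<N. \<bar>g k j\<bar> * M j) * norm_L2 T f" if f: "f \<in> L2 T" for f
  proof -
    have "\<bar>coord k f\<bar> \<le> (\<Sum>j<N. \<bar>g k j * L2_inner T (e j) f\<bar>)" unfolding coord_def by (rule sum_abs)
    also have "\<dots> \<le> (\<Sum>j<N. \<bar>g k j\<bar> * (M j * norm_L2 T f))"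
      unfolding abs_mult using M f by (intro sum_mono mult_left_mono) auto
    finally show ?thesis by (simp add: sum_distrib_right mult.assoc)
  qed
  moreover have "(\<Sum>j<N. \<bar>g k j\<bar> * M j) \<ge> 0" using M by (intro sum_nonneg) auto
  ultimately show ?thesis by blast
qed

lemma inner_bounded_sum: "\<exists>M. \<forall>f\<in>L2 T. (\<Sum>k<N. \<bar>m k * L2_inner T (e k) f\<bar>) \<le> M * norm_L2 T f"
proof -
  have "\<exists>M. \<forall>j\<in>{..<N}. M j \<ge> 0 \<and> (\<forall>f\<in>L2 T. \<bar>L2_inner T (e j) f\<bar> \<le> M j * norm_L2 T f)"
    by (intro bchoice ballI L2_inner_bounded cont) simp
  then obtain M where M: "\<forall>j\<in>{..<N}. M j \<ge> 0 \<and> (\<forall>f\<in>L2 T. \<bar>L2_inner T (e j) f\<bar> \<le> M j * norm_L2 T f)"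
    by (rule exE)
  have "(\<Sum>k<N. \<bar>m k * L2_inner T (e k) f\<bar>) \<le> (\<Sum>k<N. \<bar>m k\<bar> * M k) * norm_L2 T f" if f: "f \<in> L2 T" for f
    unfolding abs_mult sum_distrib_right mult.assoc using M f by (intro sum_mono mult_left_mono) auto
  then show ?thesis by blast
qed

lemma K_bounded_linear: "L2_bounded_linear T (L2 T) (L2 T) K"
  unfolding L2_bounded_linear_def
proof (intro conjI ballI allI)
  show "K f \<in> L2 T" if "f \<in> L2 T" for f by (rule K_L2[OF that])
  show "L2_eq T (K (\<lambda>x. f x + h x)) (\<lambda>x. K f x + K h x)" if "f \<in> L2 T" "h \<in> L2 T" for f h
  proof (rule L2_eqI)
    fix x assume x: "x \<in> {0<..<T}"
    have "(\<Sum>k<N. m k * L2_inner T (e k) (\<lambda>x. f x + h x) * e k x) =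
        (\<Sum>k<N. m k * L2_inner T (e k) f * e k x + m k * L2_inner T (e k) h * e k x)"
      using that by (intro sum.cong refl) (simp add: L2_inner_add cont algebra_simps)
    then show "K (\<lambda>x. f x + h x) x = K f x + K h x"
      using K[OF L2_add[OF that] x] K[OF that(1) x] K[OF that(2) x] by (simp add: sum.distrib)
  qed
  show "L2_eq T (K (\<lambda>x. c * f x)) (\<lambda>x. c * K f x)" if f: "f \<in> L2 T" for c f
    using K[OF L2_cmult[OF f]] K[OF f] by (intro L2_eqI) (simp add: L2_inner_cmult sum_distrib_left mult_ac)
  obtain M where M: "M \<ge> 0" "\<And>c. norm_L2 T (\<lambda>x. \<Sum>k<N. c k * e k x) \<le> M * (\<Sum>k<N. \<bar>c k\<bar>)"
    using combination_bounded by blast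
  obtain M' where M': "\<And>f. f \<in> L2 T \<Longrightarrow> (\<Sum>k<N. \<bar>m k * L2_inner T (e k) f\<bar>) \<le> M' * norm_L2 T f"
    using inner_bounded_sum by blast
  have "norm_L2 T (K f) \<le> M * M' * norm_L2 T f" if f: "f \<in> L2 T" for f
  proof -
    have "norm_L2 T (K f) = norm_L2 T (\<lambda>x. \<Sum>k<N. m k * L2_inner T (e k) f * e k x)"
      by (rule norm_L2_cong[OF K_L2[OF f] combination_L2 K_eq[OF f]])
    also have "\<dots> \<le> M * (\<Sum>k<N. \<bar>m k * L2_inner T (e k) f\<bar>)" by (rule M(2))
    also have "\<dots> \<le> M * (M' * norm_L2 T f)" by (rule mult_left_mono[OF M'[OF f] M(1)])
    finally show ?thesis by (simp add: mult.assoc)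
  qed
  then show "\<exists>M. \<forall>f\<in>L2 T. norm_L2 T (K f) \<le> M * norm_L2 T f" by blast
qed

text \<open>The spanning set has to be indexed by functions instead of numbers; the coefficients of equal
  functions are added up.\<close>
theorem K_finite_rank: "L2_finite_rank T K"
  unfolding L2_finite_rank_def
proof (intro conjI K_bounded_linear exI[of _ "e ` {..<N}"] ballI)
  show "finite (e ` {..<N})" by simp
  show "e ` {..<N} \<subseteq> L2 T" using e_L2 by auto
  fix f assume f: "f \<in> L2 T"
  define c where "c b = (\<Sum>k | k \<in> {..<N} \<and> e k = b. m k * L2_inner T (e k) f)" for b
  have "K f x = (\<Sum>b\<in>e ` {..<N}. c b * b x)" if x: "x \<in> {0<..<T}" for x
  proof -
    have "K f x = (\<Sum>b\<in>e ` {..<N}. \<Sum>k | k \<in> {..<N} \<and> e k = b. m k * L2_inner T (e k) f * e k x)"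
      unfolding K[OF f x] by (rule sum.image_gen) simp
    also have "\<dots> = (\<Sum>b\<in>e ` {..<N}. c b * b x)"
      unfolding c_def sum_distrib_right by (intro sum.cong refl) auto
    finally show ?thesis .
  qed
  then show "\<exists>c. L2_eq T (K f) (\<lambda>x. \<Sum>b\<in>e ` {..<N}. c b * b x)"
    by (intro exI[of _ c] L2_eqI) auto
qed

text \<open>The span contains a function with prescribed inner products with all \<open>e k\<close>: its coefficients solve a linear
  system with the Gram matrix.\<close>
lemma combination_interpolates:
  obtains h where "h \<in> L2 T" "\<And>i. i < N \<Longrightarrow> L2_inner T (e i) h = y i" "\<exists>c. h = (\<lambda>x. \<Sum>k<N. c k * e k x)"
proof -
  define c where "c k = (\<Sum>j<N. g k j * y j)" for k
  have "L2_inner T (e i) (\<lambda>x. \<Sum>k<N. c k * e k x) = y i" if i: "i < N" for i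
  proof -
    have "L2_inner T (e i) (\<lambda>x. \<Sum>k<N. c k * e k x) = (\<Sum>k<N. \<Sum>j<N. y j * (L2_inner T (e i) (e k) * g k j))"
      unfolding inner_combination[OF i] by (simp add: c_def sum_distrib_right sum_distrib_left mult_ac)
    also have "\<dots> = (\<Sum>j<N. \<Sum>k<N. y j * (L2_inner T (e i) (e k) * g k j))" by (rule sum.swap)
    also have "\<dots> = (\<Sum>j<N. if j = i then y j else 0)"
      using i by (intro sum.cong refl) (auto simp: sum_distrib_left[symmetric] gram_right)
    finally show ?thesis using i by simp
  qed
  then show ?thesis using that[OF combination_L2] by blast
qed

text \<open>Together with the definition of \<open>K\<close> this identifies the range with the span of the \<open>e k\<close>.\<close>
lemma combination_in_range: "(\<lambda>x. \<Sum>k<N. c k * e k x) \<in> L2_range T K"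
proof -
  obtain h where h: "h \<in> L2 T" "\<And>i. i < N \<Longrightarrow> L2_inner T (e i) h = c i / m i"
    using combination_interpolates[of "\<lambda>i. c i / m i"] by blast
  have "m k * L2_inner T (e k) h = c k" if "k < N" for k
    using h(2)[OF that] m[OF that] by simp
  then have "L2_eq T (\<lambda>x. \<Sum>k<N. c k * e k x) (K h)"
    by (intro L2_eqI) (simp add: K[OF h(1)])
  then show ?thesis using h(1) combination_L2 by (auto simp: L2_range_def)
qed

lemma range_L2: "f \<in> L2_range T K \<Longrightarrow> f \<in> L2 T"
  by (simp add: L2_range_def)

lemma range_expansion:
  assumes "f \<in> L2_range T K"
  shows "L2_eq T f (\<lambda>x. \<Sum>k<N. coord k f * e k x)"
proof -
  obtain f' where f': "f' \<in> L2 T" "L2_eq T f (K f')" using assms by (auto simp: L2_range_def)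
  let ?c = "\<lambda>k. m k * L2_inner T (e k) f'"
  have eq: "L2_eq T f (\<lambda>x. \<Sum>k<N. ?c k * e k x)" using L2_eq_trans[OF f'(2) K_eq[OF f'(1)]] .
  have "coord k f = ?c k" if "k < N" for k
    using coord_cong[OF range_L2[OF assms] combination_L2 eq] coord_combination[OF that] by metis
  then have "(\<lambda>x. \<Sum>k<N. coord k f * e k x) = (\<lambda>x. \<Sum>k<N. ?c k * e k x)" by auto
  then show ?thesis using eq by simp
qed

text \<open>The coordinates of \<open>f\<close> are recovered from those of \<open>K f\<close>; on the range this is a formula for the inverse of \<open>K\<close>,
  and it yields both injectivity and the lower bound.\<close>
lemma coord_of_coord_K:
  assumes f: "f \<in> L2 T"
  shows "coord k f = (\<Sum>j<N. g k j / m j * coord j (K f))"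
  unfolding coord_def[of k]
proof (intro sum.cong refl)
  fix j assume "j \<in> {..<N}"
  then have j: "j < N" by simp
  show "g k j * L2_inner T (e j) f = g k j / m j * coord j (K f)"
    using m[OF j] by (simp add: coord_K[OF f j])
qed

text \<open>Surjectivity: the image \<open>K f\<close> only depends on the inner products \<open>\<langle>e\<^sub>k, f\<rangle>\<close>, and these are also attained by an element of the
  span. Injectivity and boundedness of the inverse: elements of the range are determined by their coordinates,
  which are bounded functions of the image.\<close>
theorem K_isomorphism_on_range: "L2_isomorphism T (L2_range T K) (L2_range T K) K"
  unfolding L2_isomorphism_def
proof (intro conjI ballI impI)
  have "K f \<in> L2_range T K" if "f \<in> L2 T" for f
    using K_L2[OF that] that L2_eqI[of T "K f" "K f"] by (auto simp: L2_range_def)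
  then show "L2_bounded_linear T (L2_range T K) (L2_range T K) K"
    using K_bounded_linear range_L2 unfolding L2_bounded_linear_def by blast
next
  fix f h assume f: "f \<in> L2_range T K" and h: "h \<in> L2_range T K" and eq: "L2_eq T (K f) (K h)"
  have coord_eq: "coord k f = coord k h" for k
    unfolding coord_of_coord_K[OF range_L2[OF f]] coord_of_coord_K[OF range_L2[OF h]]
    using coord_cong[OF K_L2[OF range_L2[OF f]] K_L2[OF range_L2[OF h]] eq] by simp
  show "L2_eq T f h"
    using range_expansion[OF f] L2_eq_sym[OF range_expansion[OF h]] unfolding coord_eq by (rule L2_eq_trans)
next
  fix h assume "h \<in> L2_range T K"
  then obtain f where f: "f \<in> L2 T" "L2_eq T h (K f)" by (auto simp: L2_range_def)
  obtain f' where f': "f' \<in> L2 T" "\<And>i. i < N \<Longrightarrow> L2_inner T (e i) f' = L2_inner T (e i) f"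
    "\<exists>c. f' = (\<lambda>x. \<Sum>k<N. c k * e k x)"
    using combination_interpolates[of "\<lambda>i. L2_inner T (e i) f"] by blast
  have "L2_eq T (K f') (K f)"
    by (intro L2_eqI) (simp add: K[OF f(1)] K[OF f'(1)] f'(2))
  then have "L2_eq T (K f') h" using L2_eq_trans[OF _ L2_eq_sym[OF f(2)]] by blast
  moreover have "f' \<in> L2_range T K" using f'(3) combination_in_range by auto
  ultimately show "\<exists>f\<in>L2_range T K. L2_eq T (K f) h" by blast
next
  obtain M where M: "M \<ge> 0" "\<And>c. norm_L2 T (\<lambda>x. \<Sum>k<N. c k * e k x) \<le> M * (\<Sum>k<N. \<bar>c k\<bar>)"
    using combination_bounded by blast
  have "\<exists>D. \<forall>j. D j \<ge> 0 \<and> (\<forall>f\<in>L2 T. \<bar>coord j f\<bar> \<le> D j * norm_L2 T f)"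
    by (intro choice allI coord_bounded)
  then obtain D where D: "\<forall>j. D j \<ge> 0 \<and> (\<forall>f\<in>L2 T. \<bar>coord j f\<bar> \<le> D j * norm_L2 T f)" by (rule exE)
  define M' where "M' = (\<Sum>k<N. \<Sum>j<N. \<bar>g k j / m j\<bar> * D j)"
  have "norm_L2 T f \<le> M * M' * norm_L2 T (K f)" if f: "f \<in> L2_range T K" for f
  proof -
    have f2: "f \<in> L2 T" by (rule range_L2[OF f])
    have Dj: "\<bar>coord j (K f)\<bar> \<le> D j * norm_L2 T (K f)" for j using D K_L2[OF f2] by blast
    have "\<bar>coord k f\<bar> \<le> (\<Sum>j<N. \<bar>g k j / m j\<bar> * D j) * norm_L2 T (K f)" for k
    proof -
      have "\<bar>coord k f\<bar> \<le> (\<Sum>j<N. \<bar>g k j / m j * coord j (K f)\<bar>)"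
        unfolding coord_of_coord_K[OF f2, of k] by (rule sum_abs)
      also have "\<dots> \<le> (\<Sum>j<N. \<bar>g k j / m j\<bar> * (D j * norm_L2 T (K f)))"
        unfolding abs_mult using Dj by (intro sum_mono mult_left_mono) auto
      finally show ?thesis by (simp add: sum_distrib_right mult.assoc)
    qed
    then have "(\<Sum>k<N. \<bar>coord k f\<bar>) \<le> (\<Sum>k<N. (\<Sum>j<N. \<bar>g k j / m j\<bar> * D j) * norm_L2 T (K f))"
      by (intro sum_mono)
    also have "\<dots> = M' * norm_L2 T (K f)" unfolding M'_def sum_distrib_right ..
    finally have s: "(\<Sum>k<N. \<bar>coord k f\<bar>) \<le> M' * norm_L2 T (K f)" .
    have "norm_L2 T f = norm_L2 T (\<lambda>x. \<Sum>k<N. coord k f * e k x)"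
      by (rule norm_L2_cong[OF f2 combination_L2 range_expansion[OF f]])
    also have "\<dots> \<le> M * (\<Sum>k<N. \<bar>coord k f\<bar>)" by (rule M(2))
    also have "\<dots> \<le> M * (M' * norm_L2 T (K f))" by (rule mult_left_mono[OF s M(1)])
    finally show ?thesis by (simp add: mult.assoc)
  qed
  then show "\<exists>M. \<forall>f\<in>L2_range T K. norm_L2 T f \<le> M * norm_L2 T (K f)" by blast
qed

end

section \<open>The connecting operator\<close>

text \<open>The inner integral of \<^const>\<open>C\<close> is evaluated with the primitive of \<^const>\<open>S\<close>; as this
  primitive is even, the absolute value in the lower limit disappears, and the product formula applies.\<close>
lemma connecting_operator_separates:
  assumes T: "T > 0" and r: "\<And>t. t \<in> {0..2 * T} \<Longrightarrow> r t = spectral_response N l m t"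
    and f: "f \<in> L2 T" and t: "t \<in> {0..T}"
  shows "C T r f t = (\<Sum>k<N. m k * L2_inner T (\<lambda>s. S (T - s) (l k)) f * S (T - t) (l k))"
proof -
  let ?e = "\<lambda>k s. S (T - s) (l k)"
  have cont: "continuous_on {0..T} (?e k)" for k by (intro continuous_intros)
  have inner: "(LINT \<tau>|lebesgue_on {\<bar>t - s\<bar>..2 * T - s - t}. r \<tau>) = (\<Sum>k<N. 2 * m k * ?e k t * ?e k s)"
    if s: "s \<in> {0..T}" for s
  proof -
    let ?I = "{\<bar>t - s\<bar>..2 * T - s - t}"
    have le: "\<bar>t - s\<bar> \<le> 2 * T - s - t" and sub: "?I \<subseteq> {0..2 * T}" using s t by auto
    have "continuous_on ?I (spectral_response N l m)"
      unfolding spectral_response_def by (intro continuous_intros)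
    then have int: "integrable (lebesgue_on ?I) (spectral_response N l m)"
      by (intro absolutely_integrable_imp_integrable absolutely_integrable_continuous_real) auto
    have "(LINT \<tau>|lebesgue_on ?I. r \<tau>) = (LINT \<tau>|lebesgue_on ?I. spectral_response N l m \<tau>)"
      using sub by (intro Bochner_Integration.integral_cong refl r) auto
    also have "\<dots> = integral ?I (spectral_response N l m)"
      by (rule lebesgue_integral_eq_integral[OF int]) simp
    also have "\<dots> = (\<Sum>k<N. m k * (S_prim (2 * T - s - t) (l k) - S_prim \<bar>t - s\<bar> (l k)))"
      unfolding spectral_response_def
      by (intro integral_unique has_integral_sum has_integral_mult_right has_integral_S le) simp
    also have "\<dots> = (\<Sum>k<N. 2 * m k * ?e k t * ?e k s)"
    proof (intro sum.cong refl)
      fix k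
      have "S_prim (2 * T - s - t) (l k) - S_prim \<bar>t - s\<bar> (l k) = 2 * ?e k s * ?e k t"
        using S_prim_diff[of "T - s" "T - t" "l k"] by (simp add: S_prim_abs algebra_simps)
      then show "m k * (S_prim (2 * T - s - t) (l k) - S_prim \<bar>t - s\<bar> (l k)) = 2 * m k * ?e k t * ?e k s"
        by simp
    qed
    finally show ?thesis .
  qed
  have "C T r f t = 1 / 2 * (LINT s|lebesgue_on {0..T}. (\<Sum>k<N. 2 * m k * ?e k t * (?e k s * f s)))"
    unfolding C_def
  proof (intro arg_cong[where f = "\<lambda>x. 1 / 2 * x"] Bochner_Integration.integral_cong refl)
    fix s assume "s \<in> space (lebesgue_on {0..T})"
    then have "s \<in> {0..T}" by simp
    then show "(LINT \<tau>|lebesgue_on {\<bar>t - s\<bar>..2 * T - s - t}. r \<tau>) * f s = (\<Sum>k<N. 2 * m k * ?e k t * (?e k s * f s))"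
      unfolding inner[OF \<open>s \<in> {0..T}\<close>] sum_distrib_right by (simp only: mult.assoc)
  qed
  also have "(LINT s|lebesgue_on {0..T}. (\<Sum>k<N. 2 * m k * ?e k t * (?e k s * f s))) =
      (\<Sum>k<N. 2 * m k * ?e k t * L2_inner T (?e k) f)"
    using L2_inner_closed_interval[OF cont f] by (subst Bochner_Integration.integral_sum) auto
  finally show ?thesis by (simp add: sum_distrib_left mult_ac)
qed

text \<open>The functions \<open>x \<mapsto> S (T - x) (l k)\<close> are independent for distinct \<open>l k\<close>, so the results on separated kernels apply.\<close>
theorem connecting_operator_isomorphism:
  assumes T: "T > 0" and inj: "inj_on l {..<N}" and m: "\<And>k. k < N \<Longrightarrow> m k > 0"
    and r: "\<And>t. t \<in> {0..2 * T} \<Longrightarrow> r t = spectral_response N l m t"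
  shows "L2_finite_rank T (C T r)" "L2_isomorphism T (L2_range T (C T r)) (L2_range T (C T r)) (C T r)"
proof -
  define e where "e k x = S (T - x) (l k)" for k x
  have cont: "continuous_on {0..T} (e k)" for k unfolding e_def by (intro continuous_intros)
  have indep: "c i = 0" if z: "\<And>x. x \<in> {0<..<T} \<Longrightarrow> (\<Sum>k<N. c k * e k x) = 0" and i: "i < N" for c i
  proof (rule S_linearly_independent[OF inj T _ i])
    fix x assume "x \<in> {0<..<T}"
    then show "(\<Sum>k<N. c k * S x (l k)) = 0" using z[of "T - x"] by (simp add: e_def)
  qed
  have "\<exists>g. \<forall>i<N. \<forall>j<N. (\<Sum>k<N. L2_inner T (e i) (e k) * g k j) = (if i = j then 1 else 0) \<and>
    (\<Sum>k<N. g i k * L2_inner T (e k) (e j)) = (if i = j then 1 else 0)"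
    by (rule gram_matrix_inverse[OF T cont]) (rule indep)
  then obtain g where g: "\<forall>i<N. \<forall>j<N. (\<Sum>k<N. L2_inner T (e i) (e k) * g k j) = (if i = j then 1 else 0) \<and>
    (\<Sum>k<N. g i k * L2_inner T (e k) (e j)) = (if i = j then 1 else 0)" by (rule exE)
  have sep: "C T r f x = (\<Sum>k<N. m k * L2_inner T (e k) f * e k x)" if "f \<in> L2 T" "x \<in> {0<..<T}" for f x
  proof -
    have "x \<in> {0..T}" using that(2) by simp
    from connecting_operator_separates[OF T r that(1) this] show ?thesis unfolding e_def[abs_def] .
  qed
  interpret separated_kernel T N m e "C T r" g
    by unfold_locales (use T m cont sep g in simp_all)
  show "L2_finite_rank T (C T r)" by (rule K_finite_rank)
  show "L2_isomorphism T (L2_range T (C T r)) (L2_range T (C T r)) (C T r)" by (rule K_isomorphism_on_range)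
qed

section \<open>Characterization of response functions\<close>

theorem theorem3:
  fixes N :: nat and T :: real and r :: "real \<Rightarrow> real"
  assumes "N \<ge> 1" and "T > 0"
  shows "(\<exists>A. jacobi_matrix N A \<and> is_response_function N A T r) \<longleftrightarrow>
     (\<exists>l \<rho> :: nat \<Rightarrow> real.
        inj_on l {1..N} \<and> (\<forall>k\<in>{1..N}. \<rho> k > 0) \<and> (\<Sum>k=1..N. 1 / \<rho> k) = 1 \<and>
        (\<forall>t\<in>{0..2 * T}. r t = (\<Sum>k=1..N. 1 / \<rho> k * S t (l k)))) \<and>
     (L2_finite_rank T (C T r) \<and>
      L2_isomorphism T (L2_range T (C T r)) (L2_range T (C T r)) (C T r))"
    (is "?lhs \<longleftrightarrow> ?spectral \<and> ?operator")
proof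
  assume ?lhs
  then obtain A where A: "jacobi_matrix N A" "is_response_function N A T r" by blast
  obtain l m p where lmp: "inj_on l {..<N} \<and> (\<forall>k<N. m k > 0) \<and> spectral_data N A l m p"
    using jacobi_matrix_spectral_data[OF A(1) assms(1)] by (elim exE)
  have inj: "inj_on l {..<N}" and sp: "spectral_data N A l m p" using lmp by auto
  have m: "m k > 0" if "k < N" for k using lmp that by simp
  have r: "r t = spectral_response N l m t" if "t \<in> {0..2 * T}" for t
    using is_response_function_iff[OF A(1) assms(1) sp assms(2)] A(2) that by blast
  have total: "(\<Sum>k<N. m k) = 1"
  proof -
    have p0: "\<forall>k<N. p 0 k = 1" and unit: "\<forall>i<N. (\<Sum>k<N. m k * p i k) = (if i = 0 then 1 else 0)"
      using sp unfolding spectral_data_def by blast+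
    have "(\<Sum>k<N. m k * p 0 k) = 1" using spec[OF unit, of 0] assms(1) by simp
    then show ?thesis using p0 by simp
  qed
  have ?spectral
  proof (intro exI conjI ballI)
    show "inj_on (\<lambda>k. l (k - 1)) {1..N}"
    proof (rule inj_onI)
      fix i k assume ik: "i \<in> {1..N}" "k \<in> {1..N}" "l (i - 1) = l (k - 1)"
      then have "i - 1 = k - 1" by (intro inj_onD[OF inj]) auto
      then show "i = k" using ik(1,2) by (simp add: le_diff_iff' eq_diff_iff)
    qed
    show "1 / m (k - 1) > 0" if "k \<in> {1..N}" for k
    proof -
      have "k - 1 < N" using that by auto
      then show ?thesis using m by simp
    qed
    show "(\<Sum>k=1..N. 1 / (1 / m (k - 1))) = 1" using total by (simp add: sum.atLeast1_atMost_eq)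
    show "r t = (\<Sum>k=1..N. 1 / (1 / m (k - 1)) * S t (l (k - 1)))" if "t \<in> {0..2 * T}" for t
      unfolding r[OF that] spectral_response_def by (simp add: sum.atLeast1_atMost_eq)
  qed
  moreover have ?operator
    using connecting_operator_isomorphism[OF assms(2) inj m r] by simp
  ultimately show "?spectral \<and> ?operator" by blast
next
  assume "?spectral \<and> ?operator"
  then have ?spectral by (rule conjunct1)
  then obtain l \<rho> where l\<rho>: "inj_on l {1..N} \<and> (\<forall>k\<in>{1..N}. \<rho> k > 0) \<and> (\<Sum>k=1..N. 1 / \<rho> k) = 1 \<and>
      (\<forall>t\<in>{0..2 * T}. r t = (\<Sum>k=1..N. 1 / \<rho> k * S t (l k)))"
    by (elim exE)
  have inj: "inj_on l {1..N}" and \<rho>: "\<forall>k\<in>{1..N}. \<rho> k > 0" "(\<Sum>k=1..N. 1 / \<rho> k) = 1"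
    and r: "\<forall>t\<in>{0..2 * T}. r t = (\<Sum>k=1..N. 1 / \<rho> k * S t (l k))"
    using l\<rho> by simp_all
  \<comment> \<open>Spectral data are numbered from \<open>0\<close>.\<close>
  define l' m where "l' k = l (Suc k)" and "m k = 1 / \<rho> (Suc k)" for k
  have inj': "inj_on l' {..<N}"
  proof (rule inj_onI)
    fix i k assume "i \<in> {..<N}" "k \<in> {..<N}" "l' i = l' k"
    then have "Suc i = Suc k" by (intro inj_onD[OF inj]) (simp_all add: l'_def)
    then show "i = k" by simp
  qed
  have m: "m k > 0" if "k < N" for k using bspec[OF \<rho>(1), of "Suc k"] that by (simp add: m_def)
  have "(\<Sum>k<N. m k) = 1" using \<rho>(2) by (simp add: sum.atLeast1_atMost_eq m_def)
  then obtain A p where A: "jacobi_matrix N A" "spectral_data N A l' m p"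
    using spectral_data_exists_jacobi_matrix[where m = m, OF inj' m _ assms(1)] by auto
  have "\<forall>t\<in>{0..2 * T}. r t = spectral_response N l' m t"
    unfolding spectral_response_def l'_def m_def using r by (simp only: sum.atLeast1_atMost_eq One_nat_def)
  then have "is_response_function N A T r"
    using is_response_function_iff[OF A(1) assms(1) A(2) assms(2), of r] by (rule iffD2[rotated])
  then show ?lhs using A(1) by (intro exI conjI)
qed

end
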